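(* Let $q\in[1,\infty]$ be fixed, let $(G_N)_{N\in\mathbb N}$ be a sequence of finite Abelian groups with $|G_N|\to\infty$ and $(k_N)_{N\in\mathbb N}$ a sequence of positive integers; write $G=G_N$, $k=k_N$. Suppose that $1\ll k\ll\log|G|$ and $m_*(G)\gg k^{1/q}|G|^{1/k}$ (with $k^{1/\infty}:=1$), and, if $q\in(1,\infty)$, additionally that $k\le\log|G|/\log\log|G|$. Suppose that $\limsup d(G)/k<1$ in the case of undirected graphs and $\limsup d(G)/k<\frac12$ in the case of directed graphs. Let $G_k$ be the undirected ($-$), respectively directed ($+$), Cayley graph of $G$ generated by $Z=[Z_1,\dots,Z_k]$ with $Z_1,\dots,Z_k$ i.i.d. uniform on $G$. Then, for all $\beta\in(0,1)$, $$\mathcal D^\pm_{G_k,q}(\beta)\,/\,\mathfrak D^\pm_q(k,|G|)\to1\quad\text{in probability as }N\to\infty,$$ where the randomness is over the choice of $Z$.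
   Context: Asymptotic notation is along the sequence $N\to\infty$: $a\ll b$ (equivalently $b\gg a$) means $a/b\to0$. $d(G)$ is the minimal size of a generating set of $G$, and $m_*(G):=\max\{\min_{j}m_j : \oplus_{j=1}^{r}\mathbb Z_{m_j}\text{ is a decomposition of }G\}$. $L_q$ graph distance and typical distance: let $z=[z_1,\dots,z_k]$ be a multiset of elements of $G$. For a path $\rho$ in the Cayley graph $G(z)$ starting at the identity, let $\rho_{i,+}$ be the number of times $z_i$ is used and $\rho_{i,-}$ the number of times $z_i^{-1}$ is used (in the directed case inverses cannot be used, so $\rho_{i,-}:=0$). The $L_q$ length of $\rho$ is $\|\rho\|_q:=\bigl(\sum_{i=1}^k(\rho_{i,+}^q+\rho_{i,-}^q)\bigr)^{1/q}$ for $q\in[1,\infty)$ and $\|\rho\|_\infty:=\max_i(\rho_{i,+}+\rho_{i,-})$. The $L_q$ distance of $x\in G$ from the identity is the minimal $L_q$ length of a path from the identity to $x$. $\mathcal B_q(R)$ is the set of $x\in G$ at $L_q$ distance at most $R$ from the identity, and for $\beta\in[0,1]$, $\mathcal D_{G(z),q}(\beta):=\min\{R\ge0:|\mathcal B_q(R)|\ge\beta|G|\}$ (infinite if there is no such $R$). The superscript $\pm$ indicates the directed ($+$) or undirected ($-$) case. Constants: $C^-_q:=2\,\Gamma(1/q+1)(qe)^{1/q}$, $C^+_q:=\frac12C^-_q$, $\mathfrak D^\pm_q(k,n):=k^{1/q}n^{1/k}/C^\pm_q$, where $q=\infty$ is interpreted as the limit $q\to\infty$ (so $C^-_\infty=2$,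 $\mathfrak D^+_\infty(k,n)=n^{1/k}$). *)

theory Defs
  imports
    "HOL-Algebra.Elementary_Groups"
    "HOL-Algebra.Product_Groups"
    "HOL-Probability.Probability"
    "HOL-Real_Asymp.Real_Asymp"
    "Graph_Theory.Arc_Walk"
begin

definition min_generators :: "('a, 'c) monoid_scheme \<Rightarrow> nat" where
  "min_generators G =
     (LEAST n. \<exists>S. S \<subseteq> carrier G \<and> finite S \<and> card S = n \<and> generate G S = carrier G)"

(* For a finite Abelian G the set below is finite and nonempty, so Max is meaningful.
   The moduli must be positive because integer_mod_group 0 is the infinite cyclic group. *)
definition m_star :: "('a, 'c) monoid_scheme \<Rightarrow> nat" where
  "m_star G = Max {Min (m ` {..<r}) | (r::nat) (m::nat \<Rightarrow> nat).
     0 < r \<and> (\<forall>j<r. 0 < m j) \<and> G \<cong> sum_group {..<r} (\<lambda>j. integer_mod_group (m j))}"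

datatype orientation = Directed | Undirected

(* The multiset [z_1, ..., z_k] is given by the family z 0, ..., z (k - 1), and the Cayley graph
   is a multigraph: the arc (x, i, s) starts at x and uses the i-th generator if s, and the
   inverse of the i-th generator otherwise. Arcs are labelled by the index i rather than by the
   group element, so repeated generators give parallel arcs. An undirected edge is the pair of
   arcs that traverse it in the two directions. *)
definition cayley_graph ::
  "orientation \<Rightarrow> ('a, 'c) monoid_scheme \<Rightarrow> nat \<Rightarrow> (nat \<Rightarrow> 'a) \<Rightarrow> ('a, 'a \<times> nat \<times> bool) pre_digraph"
where
  "cayley_graph dir G k z =
     \<lparr>verts = carrier G,
      arcs = carrier G \<times> {..<k} \<times> (case dir of Directed \<Rightarrow> {True} | Undirected \<Rightarrow> UNIV),
      tail = (\<lambda>(x, i, s). x),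
      head = (\<lambda>(x, i, s). if s then x \<otimes>\<^bsub>G\<^esub> z i else x \<otimes>\<^bsub>G\<^esub> inv\<^bsub>G\<^esub> z i)\<rparr>"

definition uses :: "('a \<times> nat \<times> bool) awalk \<Rightarrow> nat \<Rightarrow> bool \<Rightarrow> nat" where
  "uses p i s = count_list (map snd p) (i, s)"

definition Lq_length :: "ereal \<Rightarrow> nat \<Rightarrow> ('a \<times> nat \<times> bool) awalk \<Rightarrow> real" where
  "Lq_length q k p =
     (if q = \<infinity> then real (Max ((\<lambda>i. uses p i True + uses p i False) ` {..<k}))
      else (\<Sum>i<k. real (uses p i True) powr real_of_ereal q
                  + real (uses p i False) powr real_of_ereal q) powr (1 / real_of_ereal q))"

(* Only finitely many values of the L_q length lie below any given bound, so the infimum is a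
   minimum, unless x cannot be reached, in which case it is infinite. *)
definition Lq_distance ::
  "ereal \<Rightarrow> orientation \<Rightarrow> ('a, 'c) monoid_scheme \<Rightarrow> nat \<Rightarrow> (nat \<Rightarrow> 'a) \<Rightarrow> 'a \<Rightarrow> ereal"
where
  "Lq_distance q dir G k z x =
     Inf {ereal (Lq_length q k p) | p. pre_digraph.awalk (cayley_graph dir G k z) \<one>\<^bsub>G\<^esub> p x}"

definition Lq_ball ::
  "ereal \<Rightarrow> orientation \<Rightarrow> ('a, 'c) monoid_scheme \<Rightarrow> nat \<Rightarrow> (nat \<Rightarrow> 'a) \<Rightarrow> real \<Rightarrow> 'a set"
where
  "Lq_ball q dir G k z R = {x \<in> carrier G. Lq_distance q dir G k z x \<le> ereal R}"

(* For finite G the cardinality of the ball is a right-continuous step function of R, so the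
   infimum is a minimum, unless the set is empty, in which case it is infinite. *)
definition typical_distance ::
  "ereal \<Rightarrow> orientation \<Rightarrow> ('a, 'c) monoid_scheme \<Rightarrow> nat \<Rightarrow> (nat \<Rightarrow> 'a) \<Rightarrow> real \<Rightarrow> ereal"
where
  "typical_distance q dir G k z \<beta> =
     Inf {ereal R | R. 0 \<le> R \<and> \<beta> * real (Coset.order G) \<le> real (card (Lq_ball q dir G k z R))}"

(* 1 / q as a real number, with the value 0 for q = \<infinity>. *)
definition recip :: "ereal \<Rightarrow> real" where
  "recip q = real_of_ereal (1 / q)"

definition C_undirected :: "ereal \<Rightarrow> real" where
  "C_undirected q =
     (if q = \<infinity> then 2
      else 2 * Gamma (1 / real_of_ereal q + 1)
             * (real_of_ereal q * exp 1) powr (1 / real_of_ereal q))"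

(* The value of C_undirected at \<infinity> is the limit of its values at finite q. *)
lemma C_undirected_tendsto: "((\<lambda>q. C_undirected (ereal q)) \<longlongrightarrow> C_undirected \<infinity>) at_top"
proof -
  have "((\<lambda>q::real. Gamma (1 / q + 1)) \<longlongrightarrow> Gamma (0 + 1)) at_top"
    by (intro tendsto_intros tendsto_divide_0[OF tendsto_const]
          filterlim_at_top_imp_at_infinity filterlim_ident) auto
  moreover have "((\<lambda>q::real. (q * exp 1) powr (1 / q)) \<longlongrightarrow> 1) at_top"
    by real_asymp
  ultimately have "((\<lambda>q::real. 2 * Gamma (1 / q + 1) * (q * exp 1) powr (1 / q))
      \<longlongrightarrow> 2 * Gamma (0 + 1) * 1) at_top"
    by (intro tendsto_mult tendsto_const)
  then show ?thesis
    by (simp add: C_undirected_def)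
qed

definition C_const :: "orientation \<Rightarrow> ereal \<Rightarrow> real" where
  "C_const dir q = (case dir of Undirected \<Rightarrow> C_undirected q | Directed \<Rightarrow> C_undirected q / 2)"

definition D_const :: "orientation \<Rightarrow> ereal \<Rightarrow> nat \<Rightarrow> nat \<Rightarrow> real" where
  "D_const dir q k n = real k powr recip q * real n powr (1 / real k) / C_const dir q"

definition iid_uniform ::
  "'b measure \<Rightarrow> ('a, 'c) monoid_scheme \<Rightarrow> nat \<Rightarrow> (nat \<Rightarrow> 'b \<Rightarrow> 'a) \<Rightarrow> bool"
where
  "iid_uniform M G k Z \<longleftrightarrow>
     prob_space.indep_vars M (\<lambda>_. count_space (carrier G)) Z {..<k} \<and>
     (\<forall>i<k. distr M (count_space (carrier G)) (Z i) = uniform_count_measure (carrier G))"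

(* Convergence in probability to a constant, for random variables that may be infinite and may
   live on different probability spaces. *)
definition tendsto_in_prob ::
  "(nat \<Rightarrow> 'b measure) \<Rightarrow> (nat \<Rightarrow> 'b \<Rightarrow> ereal) \<Rightarrow> real \<Rightarrow> bool"
where
  "tendsto_in_prob M X c \<longleftrightarrow>
     (\<forall>\<epsilon>>0. (\<lambda>N. measure (M N) {\<omega> \<in> space (M N). ereal \<epsilon> < \<bar>X N \<omega> - ereal c\<bar>})
               \<longlonglongrightarrow> 0)"

definition much_less :: "(nat \<Rightarrow> real) \<Rightarrow> (nat \<Rightarrow> real) \<Rightarrow> bool" (infix "\<lless>" 50) where
  "a \<lless> b \<longleftrightarrow> (\<lambda>N. a N / b N) \<longlonglongrightarrow> 0"

end

theory Submission
  imports Defs "HOL-Algebra.FiniteProduct"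
begin

text \<open>
  The ball of radius \<open>R\<close> in the Cayley graph is the image of the lattice ball \<open>B\<close> of radius \<open>R\<close> in
  \<open>\<int>\<^sup>k\<close> (in \<open>\<nat>\<^sup>k\<close> if directed) under \<open>w \<mapsto> w \<cdot> Z\<close>. Its volume is
  \<open>(C * R / k powr (1 / q)) ^ k\<close> up to a subexponential factor, so for \<open>R = (1 - \<epsilon>) * D\<close> it contains
  \<open>o(n)\<close> points, \<open>n\<close> being the order of the group \<open>G\<close>, and for \<open>R = (1 + \<epsilon>) * D\<close> exponentially more
  than \<open>n\<close>.

  In the latter case let \<open>w, w'\<close> be independent uniform points of \<open>B\<close>. By the Cauchy-Schwarz inequality the image of
  \<open>B\<close> has at least \<open>n / X\<close> elements, where \<open>X\<close> is \<open>n\<close> times the conditional probability of \<open>w \<cdot> Z = w' \<cdot> Z\<close>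
  given \<open>Z\<close>. Since \<open>(w - w') \<cdot> Z\<close> is uniform on \<open>g G\<close> with \<open>g = gcd (w - w')\<close>, the expectation of
  \<open>X\<close> is the mean of \<open>|G / g G| \<le> min n (g ^ d)\<close>, where \<open>d\<close> is the minimal number of generators, and it remains to show that
  \<open>g \<ge> 2\<close> contributes \<open>o(1)\<close>. The probability of \<open>w \<equiv> w' (mod g)\<close> is about \<open>g powr (-k)\<close>
  as long as \<open>g\<close> is at most a large multiple of \<open>n powr (1 / k)\<close>; beyond that, a residue class meets
  \<open>B\<close> in at most \<open>exp (\<eta> * k)\<close> points with small \<open>\<eta>\<close>, since its points differ in few coordinates.
\<close>

text \<open>Counts matter only up to factors \<open>(1 + o(1)) ^ k\<close>, which \<epsilon>
  absorbs. Put L = n powr (1 / k); it tends to infinity because k << ln n. In units of k powr (1 /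
  q), the norm of the all-ones vector, the relevant radii are of order L, so adding that vector to a
  point changes the radius only by a factor 1 + O(1 / L). The shift turns nonnegative coordinates
  into positive ones, and the numbers of these two kinds of lattice points enclose the volume.
  Always X >= 1, since the image lies in G. An expectation 1 + o(1) therefore forces X close to 1 in
  probability, which serves every \<beta> < 1. This is why the contribution of g >= 2 has to vanish
  and not merely stay bounded. Large g are the obstacle. The volume estimate of a residue class
  never falls below a ^ k, with a close to C and possibly above 1. Multiplied by an index that may
  be as large as n, it can outweigh the size of B, which exceeds n only by about (1 + \<epsilon>) ^
  k. Hence the separate estimate for these g, with \<eta> tuned to \<epsilon>.\<close>

section \<open>Lattice balls\<close>

text \<open>For \<open>q = \<infinity>\<close> and \<open>k = 0\<close> the maximum below is over the empty set and unspecified.\<close>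
definition lnorm :: "ereal \<Rightarrow> nat \<Rightarrow> (nat \<Rightarrow> real) \<Rightarrow> real" where
  "lnorm q k w =
     (if q = \<infinity> then Max ((\<lambda>i. \<bar>w i\<bar>) ` {..<k})
      else (\<Sum>i<k. \<bar>w i\<bar> powr real_of_ereal q) powr (1 / real_of_ereal q))"

section \<open>Monotonicity, scaling and unit shift of the norm\<close>

lemma exponent_cases [consumes 1, case_names finite infinite]:
  assumes "1 \<le> (q::ereal)"
  obtains p where "q = ereal p" "1 \<le> p" | "q = \<infinity>"
  using assms by (cases q) (auto simp: one_ereal_def)

lemma recip_ereal [simp]: "p \<noteq> 0 \<Longrightarrow> recip (ereal p) = 1 / p"
  by (simp add: recip_def one_ereal_def)

lemma recip_infty [simp]: "recip \<infinity> = 0"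
  by (simp add: recip_def)

lemma lnorm_infty_le_iff:
  assumes "0 < k"
  shows "lnorm \<infinity> k w \<le> R \<longleftrightarrow> (\<forall>i<k. \<bar>w i\<bar> \<le> R)"
proof -
  have "(\<lambda>i. \<bar>w i\<bar>) ` {..<k} \<noteq> {}"
    using assms by auto
  then show ?thesis
    by (auto simp: lnorm_def)
qed

lemma lnorm_ereal_le_iff:
  assumes "1 \<le> p" "0 \<le> R"
  shows "lnorm (ereal p) k w \<le> R \<longleftrightarrow> (\<Sum>i<k. \<bar>w i\<bar> powr p) \<le> R powr p"
proof -
  have s: "0 \<le> (\<Sum>i<k. \<bar>w i\<bar> powr p)" by (intro sum_nonneg) auto
  have "(\<Sum>i<k. \<bar>w i\<bar> powr p) powr (1/p) \<le> R \<longleftrightarrow>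
     ((\<Sum>i<k. \<bar>w i\<bar> powr p) powr (1/p)) powr p \<le> R powr p"
    using assms by (smt (verit, best) powr_ge_zero powr_le_cancel_iff powr_mono2 powr_less_mono2)
  also have "((\<Sum>i<k. \<bar>w i\<bar> powr p) powr (1/p)) powr p = (\<Sum>i<k. \<bar>w i\<bar> powr p)"
    using assms s by (simp add: powr_powr)
  finally show ?thesis
    by (simp add: lnorm_def)
qed

lemma lnorm_nonneg: "0 < k \<Longrightarrow> 0 \<le> lnorm q k w"
proof (cases "q = \<infinity>")
  case True
  assume "0 < k"
  then have "\<bar>w 0\<bar> \<le> lnorm q k w"
    unfolding lnorm_def using True by (auto intro!: Max_ge)
  then show ?thesis by linarith
qed (auto simp: lnorm_def)

lemma lnorm_le_mono:
  assumes "1 \<le> q" "0 < k" "\<And>i. i < k \<Longrightarrow> \<bar>u i\<bar> \<le> \<bar>v i\<bar>" "lnorm q k v \<le> R"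
  shows "lnorm q k u \<le> R"
proof -
  have R: "0 \<le> R" using lnorm_nonneg[OF assms(2), of q v] assms(4) by linarith
  show ?thesis using assms(1)
  proof (cases rule: exponent_cases)
    case (finite p)
    have "(\<Sum>i<k. \<bar>u i\<bar> powr p) \<le> (\<Sum>i<k. \<bar>v i\<bar> powr p)"
      using assms(3) finite by (intro sum_mono powr_mono2) auto
    then show ?thesis
      using assms(4) R finite by (simp add: lnorm_ereal_le_iff)
  next
    case infinite
    then show ?thesis using assms by (fastforce simp: lnorm_infty_le_iff)
  qed
qed

lemma lnorm_scale_le:
  assumes "1 \<le> q" "0 < k" "0 \<le> c" "lnorm q k v \<le> R"
  shows "lnorm q k (\<lambda>i. c * v i) \<le> c * R"
proof -
  have R: "0 \<le> R" using lnorm_nonneg[OF assms(2), of q v] assms(4) by linarith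
  show ?thesis using assms(1)
  proof (cases rule: exponent_cases)
    case (finite p)
    have "(\<Sum>i<k. \<bar>c * v i\<bar> powr p) = c powr p * (\<Sum>i<k. \<bar>v i\<bar> powr p)"
      using assms(3) by (simp add: abs_mult powr_mult sum_distrib_left)
    also have "\<dots> \<le> c powr p * R powr p"
      using assms(4) R finite by (intro mult_left_mono) (simp_all add: lnorm_ereal_le_iff)
    finally show ?thesis
      using R assms(3) finite by (simp add: lnorm_ereal_le_iff powr_mult)
  next
    case infinite
    then show ?thesis using assms by (auto simp: lnorm_infty_le_iff abs_mult mult_left_mono)
  qed
qed

lemma coordinate_le_lnorm:
  assumes "1 \<le> q" "i < k" "lnorm q k v \<le> R"
  shows "\<bar>v i\<bar> \<le> R"
proof -
  have k: "0 < k" using assms(2) by auto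
  then have R: "0 \<le> R" using lnorm_nonneg[of k q v] assms(3) by linarith
  show ?thesis using assms(1)
  proof (cases rule: exponent_cases)
    case (finite p)
    have "\<bar>v i\<bar> powr p \<le> (\<Sum>i<k. \<bar>v i\<bar> powr p)"
      using assms(2) by (intro member_le_sum) auto
    also have "\<dots> \<le> R powr p" using assms(3) R finite by (simp add: lnorm_ereal_le_iff)
    finally show ?thesis using R finite(2) 
      by (smt (verit, best) powr_less_mono2)
  next
    case infinite
    then show ?thesis using assms k by (auto simp: lnorm_infty_le_iff)
  qed
qed

lemma powr_convex_combination:
  fixes x y t p :: real
  assumes "1 \<le> p" "0 \<le> x" "0 < y" "0 < t" "t < 1"
  shows "((1 - t) * x + t * y) powr p \<le> (1 - t) * x powr p + t * y powr p"
proof (cases "x = 0")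
  case True
  have "t powr p \<le> t powr 1" using assms by (intro powr_mono') auto
  then show ?thesis using True assms by (simp add: powr_mult mult_right_mono)
next
  case False
  then show ?thesis
    using convex_onD[OF powr_convex[OF assms(1)], of t x y] assms by simp
qed

text \<open>Minkowski's inequality for |w| and the all-ones vector. Both are scaled to norm at most
  1 and recombined with weights \<open>1 - t\<close> and \<open>t\<close> proportional to R and
  \<kappa>; convexity of x powr p is applied in each coordinate.\<close>

lemma lnorm_shift_le:
  assumes "1 \<le> q" "0 < k" "lnorm q k w \<le> R"
  shows "lnorm q k (\<lambda>i. \<bar>w i\<bar> + 1) \<le> R + real k powr recip q"
proof -
  have R: "0 \<le> R" using lnorm_nonneg[OF assms(2), of q w] assms(3) by linarith
  show ?thesis using assms(1)
  proof (cases rule: exponent_cases)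
    case (finite p)
    define \<kappa> where "\<kappa> = real k powr (1 / p)"
    have \<kappa>: "0 < \<kappa>" "\<kappa> powr p = real k"
      using assms(2) finite by (auto simp: \<kappa>_def powr_powr)
    have sum: "(\<Sum>i<k. \<bar>w i\<bar> powr p) \<le> R powr p"
      using assms(3) R finite by (simp add: lnorm_ereal_le_iff)
    have "(\<Sum>i<k. (\<bar>w i\<bar> + 1) powr p) \<le> (R + \<kappa>) powr p"
    \<comment> \<open>The scaling divides by R. If R = 0, then w vanishes and both sides are equal
      to k.\<close>
    proof (cases "R = 0")
      case True
      have "w i = 0" if "i < k" for i
        using coordinate_le_lnorm[OF assms(1) that assms(3)] True by simp
      then show ?thesis using True \<kappa> by simp
    next
      case False
      define t where "t = \<kappa> / (R + \<kappa>)"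
      have t: "0 < t" "t < 1" "1 - t = R / (R + \<kappa>)"
        using \<kappa> False R by (auto simp: t_def field_simps)
      have "(\<bar>w i\<bar> + 1) powr p
              \<le> (R + \<kappa>) powr p * ((1 - t) * (\<bar>w i\<bar> / R) powr p + t * (1 / \<kappa>) powr p)" for i
      proof -
        have "\<bar>w i\<bar> + 1 = (R + \<kappa>) * ((1 - t) * (\<bar>w i\<bar> / R) + t * (1 / \<kappa>))"
        proof -
          have "(1 - t) * (\<bar>w i\<bar> / R) = \<bar>w i\<bar> / (R + \<kappa>)" "t * (1 / \<kappa>) = 1 / (R + \<kappa>)"
            using \<kappa>(1) False unfolding t(3) by (simp_all add: t_def)
          then show ?thesis
            using \<kappa>(1) R by (simp flip: add_divide_distrib)
        qed
        also have "\<dots> powr p = (R + \<kappa>) powr p * ((1 - t) * (\<bar>w i\<bar> / R) + t * (1 / \<kappa>)) powr p"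
          by (rule powr_mult)
        also have "\<dots> \<le> (R + \<kappa>) powr p * ((1 - t) * (\<bar>w i\<bar> / R) powr p + t * (1 / \<kappa>) powr p)"
          using R \<kappa> t finite by (intro mult_left_mono powr_convex_combination) auto
        finally show ?thesis .
      qed
      then have "(\<Sum>i<k. (\<bar>w i\<bar> + 1) powr p)
          \<le> (\<Sum>i<k. (R + \<kappa>) powr p * ((1 - t) * (\<bar>w i\<bar> / R) powr p + t * (1 / \<kappa>) powr p))"
        by (intro sum_mono)
      also have "\<dots> = (R + \<kappa>) powr p *
          ((1 - t) * ((\<Sum>i<k. \<bar>w i\<bar> powr p) / R powr p) + t * (real k * (1 / \<kappa>) powr p))"
        by (simp add: sum_distrib_left sum.distrib powr_divide sum_divide_distrib algebra_simps)
      also have "real k * (1 / \<kappa>) powr p = 1"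
        using \<kappa> assms(2) by (simp add: powr_divide)
      also have "(R + \<kappa>) powr p * ((1 - t) * ((\<Sum>i<k. \<bar>w i\<bar> powr p) / R powr p) + t * 1)
          \<le> (R + \<kappa>) powr p * ((1 - t) * 1 + t * 1)"
        using sum t R False
        by (intro mult_left_mono add_mono order_refl) (auto simp: field_simps)
      finally show ?thesis by simp
    qed
    moreover have "\<bar>\<bar>w i\<bar> + 1\<bar> = \<bar>w i\<bar> + 1" for i by simp
    ultimately show ?thesis
      using R \<kappa> finite by (simp add: lnorm_ereal_le_iff \<kappa>_def [symmetric])
  next
    case infinite
    then show ?thesis using assms by (auto simp: lnorm_infty_le_iff)
  qed
qed

section \<open>Lattice balls, their orthants and residue classes\<close>

definition coords :: "orientation \<Rightarrow> int set" where
  "coords dir = (case dir of Directed \<Rightarrow> {0..} | Undirected \<Rightarrow> UNIV)"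

text \<open>\<open>True\<close> stands for a negative coordinate. The cardinality, 1 or 2, is the
  ratio of \<open>C_const dir q\<close> to \<open>C_const Directed q\<close>.\<close>

definition signs :: "orientation \<Rightarrow> bool set" where
  "signs dir = (case dir of Directed \<Rightarrow> {False} | Undirected \<Rightarrow> UNIV)"

definition lattice_ball :: "orientation \<Rightarrow> ereal \<Rightarrow> nat \<Rightarrow> real \<Rightarrow> (nat \<Rightarrow> int) set" where
  "lattice_ball dir q k R =
     {w \<in> {..<k} \<rightarrow>\<^sub>E coords dir. lnorm q k (\<lambda>i. real_of_int (w i)) \<le> R}"

text \<open>Used with c = 0 and c = 1. Unit cubes with lower corners at the points for c = 0 cover
  the orthant part of the real ball, and unit cubes with upper corners at the points for c = 1 lie
  inside it.\<close>

definition orthant_ball :: "nat \<Rightarrow> ereal \<Rightarrow> nat \<Rightarrow> real \<Rightarrow> (nat \<Rightarrow> nat) set" where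
  "orthant_ball c q k R = {w \<in> {..<k} \<rightarrow>\<^sub>E {c..}. lnorm q k (\<lambda>i. real (w i)) \<le> R}"

lemma finite_lattice_ball:
  assumes "1 \<le> q"
  shows "finite (lattice_ball dir q k R)"
proof (rule finite_subset)
  show "lattice_ball dir q k R \<subseteq> {..<k} \<rightarrow>\<^sub>E {- \<lfloor>R\<rfloor> .. \<lfloor>R\<rfloor>}"
  proof
    fix w assume w: "w \<in> lattice_ball dir q k R"
    have "w i \<in> {- \<lfloor>R\<rfloor> .. \<lfloor>R\<rfloor>}" if "i < k" for i
    proof -
      have "\<bar>real_of_int (w i)\<bar> \<le> R"
        using w that assms by (intro coordinate_le_lnorm[of q i k]) (auto simp: lattice_ball_def)
      then have "real_of_int \<bar>w i\<bar> \<le> R" by simp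
      then have "\<bar>w i\<bar> \<le> \<lfloor>R\<rfloor>" by (simp only: le_floor_iff)
      then show ?thesis by auto
    qed
    then show "w \<in> {..<k} \<rightarrow>\<^sub>E {- \<lfloor>R\<rfloor> .. \<lfloor>R\<rfloor>}"
      using w by (auto simp: lattice_ball_def PiE_iff)
  qed
qed (auto intro: finite_PiE)

lemma finite_orthant_ball:
  assumes "1 \<le> q"
  shows "finite (orthant_ball c q k R)"
proof (rule finite_subset)
  show "orthant_ball c q k R \<subseteq> {..<k} \<rightarrow>\<^sub>E {.. nat \<lfloor>R\<rfloor>}"
  proof
    fix w assume w: "w \<in> orthant_ball c q k R"
    have "w i \<in> {.. nat \<lfloor>R\<rfloor>}" if "i < k" for i
    proof -
      have "\<bar>real (w i)\<bar> \<le> R"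
        using w that assms by (intro coordinate_le_lnorm[of q i k]) (auto simp: orthant_ball_def)
      then show ?thesis by (simp add: le_nat_floor)
    qed
    then show "w \<in> {..<k} \<rightarrow>\<^sub>E {.. nat \<lfloor>R\<rfloor>}"
      using w by (auto simp: orthant_ball_def PiE_iff)
  qed
qed (auto intro: finite_PiE)

lemma restrict_eq_iff: "restrict f A = restrict g A \<longleftrightarrow> (\<forall>x\<in>A. f x = g x)"
  by (metis restrict_apply' restrict_ext)

lemma lnorm_cong:
  assumes "\<And>i. i < k \<Longrightarrow> u i = v i"
  shows "lnorm q k u = lnorm q k v"
proof -
  have "(\<lambda>i. \<bar>u i\<bar>) ` {..<k} = (\<lambda>i. \<bar>v i\<bar>) ` {..<k}"
    using assms by (intro image_cong) auto
  then show ?thesis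
    using assms by (simp add: lnorm_def)
qed

lemma lnorm_restrict [simp]:
  "lnorm q k (\<lambda>i. real (restrict u {..<k} i)) = lnorm q k (\<lambda>i. real (u i))"
  "lnorm q k (\<lambda>i. real_of_int (restrict v {..<k} i)) = lnorm q k (\<lambda>i. real_of_int (v i))"
  by (auto intro: lnorm_cong)

text \<open>Within a residue class, the sign of \<open>w i\<close> fixes the residue of |w i|, so
  the sign and the quotient |w i| div g determine \<open>w i\<close>. Taking quotients shrinks the
  norm by the factor g.\<close>

lemma card_lattice_ball_class_le:
  assumes "1 \<le> q" "0 < k" "0 < g"
  shows "card {w \<in> lattice_ball dir q k R. \<forall>i<k. w i mod int g = a i mod int g}
           \<le> card (signs dir) ^ k * card (orthant_ball 0 q k (R / real g))"
proof -
  define \<phi> :: "(nat \<Rightarrow> int) \<Rightarrow> (nat \<Rightarrow> bool) \<times> (nat \<Rightarrow> nat)" where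
    "\<phi> w = (restrict (\<lambda>i. w i < 0) {..<k}, restrict (\<lambda>i. nat (\<bar>w i\<bar> div int g)) {..<k})" for w
  let ?X = "{w \<in> lattice_ball dir q k R. \<forall>i<k. w i mod int g = a i mod int g}"
  let ?Y = "({..<k} \<rightarrow>\<^sub>E signs dir) \<times> orthant_ball 0 q k (R / real g)"
  have "\<phi> ` ?X \<subseteq> ?Y"
  proof
    fix y assume "y \<in> \<phi> ` ?X"
    then obtain w where w: "w \<in> lattice_ball dir q k R" and y: "y = \<phi> w" by blast
    have "lnorm q k (\<lambda>i. real (nat (\<bar>w i\<bar> div int g))) \<le> (1 / real g) * R"
    proof (rule lnorm_le_mono[OF assms(1,2)])
      show "lnorm q k (\<lambda>i. (1 / real g) * real_of_int (w i)) \<le> (1 / real g) * R"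
        using w assms by (intro lnorm_scale_le) (auto simp: lattice_ball_def)
      fix i
      have "int g * (\<bar>w i\<bar> div int g) \<le> \<bar>w i\<bar>"
        using mult_div_mod_eq[of "int g" "\<bar>w i\<bar>"] pos_mod_sign[of "int g" "\<bar>w i\<bar>"] assms(3)
        by linarith
      then have "real g * real_of_int (\<bar>w i\<bar> div int g) \<le> \<bar>real_of_int (w i)\<bar>"
        unfolding of_int_le_iff [symmetric, where 'a = real] by simp
      moreover have "0 \<le> \<bar>w i\<bar> div int g" by (simp add: pos_imp_zdiv_nonneg_iff assms(3))
      ultimately show "\<bar>real (nat (\<bar>w i\<bar> div int g))\<bar> \<le> \<bar>(1 / real g) * real_of_int (w i)\<bar>"
        using assms(3) by (simp add: field_simps abs_mult)
    qed
    then have 2: "restrict (\<lambda>i. nat (\<bar>w i\<bar> div int g)) {..<k} \<in> orthant_ball 0 q k (R / real g)"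
      unfolding orthant_ball_def by (simp only: lnorm_restrict mem_Collect_eq) auto
    have 1: "restrict (\<lambda>i. w i < 0) {..<k} \<in> {..<k} \<rightarrow>\<^sub>E signs dir"
      using w by (force simp: lattice_ball_def signs_def coords_def PiE_iff split: orientation.splits)
    show "y \<in> ?Y" using 1 2 unfolding y \<phi>_def by blast
  qed
  moreover have "inj_on \<phi> ?X"
  proof (rule inj_onI)
    fix u v assume u: "u \<in> ?X" and v: "v \<in> ?X" and eq: "\<phi> u = \<phi> v"
    have "u i = v i" if i: "i < k" for i
    proof -
      have s: "u i < 0 \<longleftrightarrow> v i < 0" and "nat (\<bar>u i\<bar> div int g) = nat (\<bar>v i\<bar> div int g)"
        using eq i by (auto simp: \<phi>_def restrict_eq_iff)
      then have d: "\<bar>u i\<bar> div int g = \<bar>v i\<bar> div int g"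
        using assms(3) by (simp add: pos_imp_zdiv_nonneg_iff eq_nat_nat_iff)
      have m: "u i mod int g = v i mod int g" using u v i by auto
      have "\<bar>u i\<bar> mod int g = \<bar>v i\<bar> mod int g"
        using s m by (metis abs_if mod_minus_cong)
      then have "\<bar>u i\<bar> = \<bar>v i\<bar>" using d by (metis div_mult_mod_eq)
      then show ?thesis using s by linarith
    qed
    then show "u = v"
      using u v by (intro PiE_ext[of u "{..<k}" "\<lambda>_. coords dir" v]) (auto simp: lattice_ball_def)
  qed
  moreover have "finite ?Y"
    by (intro finite_cartesian_product finite_PiE finite_orthant_ball assms)
       (auto simp: signs_def split: orientation.splits)
  ultimately have "card ?X \<le> card ?Y"
    by (meson card_inj_on_le)
  then show ?thesis
    by (simp add: card_cartesian_product card_PiE)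
qed

text \<open>Translation by the all-ones vector; the increase of the radius is the norm of that
  vector.\<close>

lemma card_orthant_ball_shift:
  assumes "1 \<le> q" "0 < k"
  shows "card (orthant_ball 0 q k R) \<le> card (orthant_ball 1 q k (R + real k powr recip q))"
proof (rule card_inj_on_le)
  let ?f = "\<lambda>w::nat \<Rightarrow> nat. restrict (\<lambda>i. w i + 1) {..<k}"
  show "inj_on ?f (orthant_ball 0 q k R)"
  proof (rule inj_onI)
    fix u v assume "u \<in> orthant_ball 0 q k R" "v \<in> orthant_ball 0 q k R" "?f u = ?f v"
    then show "u = v"
      by (intro PiE_ext[of u "{..<k}" "\<lambda>_. {0..}" v]) (auto simp: orthant_ball_def restrict_eq_iff)
  qed
  show "?f ` orthant_ball 0 q k R \<subseteq> orthant_ball 1 q k (R + real k powr recip q)"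
  proof
    fix y assume "y \<in> ?f ` orthant_ball 0 q k R"
    then obtain w where "w \<in> orthant_ball 0 q k R" and y: "y = ?f w" by blast
    then have "lnorm q k (\<lambda>i. real (w i)) \<le> R" by (simp add: orthant_ball_def)
    from lnorm_shift_le[OF assms this]
    have "lnorm q k (\<lambda>i. real (w i + 1)) \<le> R + real k powr recip q" by (simp add: add.commute)
    then show "y \<in> orthant_ball 1 q k (R + real k powr recip q)"
      unfolding y orthant_ball_def by (simp only: lnorm_restrict mem_Collect_eq) auto
  qed
qed (rule finite_orthant_ball[OF assms(1)])

text \<open>Positive coordinates keep different sign patterns apart; a coordinate 0 would be counted
  twice.\<close>

lemma card_lattice_ball_ge:
  assumes "1 \<le> q" "0 < k"
  shows "card (signs dir) ^ k * card (orthant_ball 1 q k R) \<le> card (lattice_ball dir q k R)"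
proof -
  let ?f = "\<lambda>(s::nat \<Rightarrow> bool, w::nat \<Rightarrow> nat). restrict (\<lambda>i. if s i then - int (w i) else int (w i)) {..<k}"
  let ?X = "({..<k} \<rightarrow>\<^sub>E signs dir) \<times> orthant_ball 1 q k R"
  have "inj_on ?f ?X"
  proof (rule inj_onI, clarify)
    fix s w s' w'
    assume s: "s \<in> {..<k} \<rightarrow>\<^sub>E signs dir" "s' \<in> {..<k} \<rightarrow>\<^sub>E signs dir"
      and w: "w \<in> orthant_ball 1 q k R" "w' \<in> orthant_ball 1 q k R"
      and eq: "restrict (\<lambda>i. if s i then - int (w i) else int (w i)) {..<k} =
        restrict (\<lambda>i. if s' i then - int (w' i) else int (w' i)) {..<k}"
    have "s i = s' i \<and> w i = w' i" if i: "i < k" for i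
    proof -
      have "(if s i then - int (w i) else int (w i)) = (if s' i then - int (w' i) else int (w' i))"
        using eq i by (simp add: restrict_eq_iff)
      moreover have "1 \<le> w i" "1 \<le> w' i" using w i by (auto simp: orthant_ball_def PiE_iff)
      ultimately show ?thesis by (auto split: if_splits)
    qed
    then show "s = s' \<and> w = w'"
      using s w by (intro conjI PiE_ext[of s "{..<k}" "\<lambda>_. signs dir" s']
          PiE_ext[of w "{..<k}" "\<lambda>_. {1..}" w']) (auto simp: orthant_ball_def)
  qed
  moreover have "?f ` ?X \<subseteq> lattice_ball dir q k R"
  proof clarify
    fix s w assume s: "s \<in> {..<k} \<rightarrow>\<^sub>E signs dir" and w: "w \<in> orthant_ball 1 q k R"
    have "lnorm q k (\<lambda>i. real_of_int (if s i then - int (w i) else int (w i))) \<le> R"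
      by (rule lnorm_le_mono[OF assms, of _ "\<lambda>i. real (w i)"]) (use w in \<open>auto simp: orthant_ball_def\<close>)
    then show "restrict (\<lambda>i. if s i then - int (w i) else int (w i)) {..<k} \<in> lattice_ball dir q k R"
      unfolding lattice_ball_def using s
      by (simp only: lnorm_restrict mem_Collect_eq)
        (auto simp: signs_def coords_def PiE_iff split: orientation.splits)
  qed
  ultimately have "card ?X \<le> card (lattice_ball dir q k R)"
    by (meson card_inj_on_le finite_lattice_ball[OF assms(1)])
  then show ?thesis
    by (simp add: card_cartesian_product card_PiE)
qed

text \<open>Rounding x / g to the nearest integer gives 0 unless |x| >= g / 2, and then the rounding
  error 1 / 2 is at most |x| / g. So rounding at most doubles the quotient and sends small x to
  0.\<close>

lemma rounded_quotient_bound: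
  fixes x g :: int
  assumes "0 < g"
  shows "g * \<bar>(x + g div 2) div g\<bar> \<le> 2 * \<bar>x\<bar>"
proof -
  define t where "t = (x + g div 2) div g"
  define m where "m = (x + g div 2) mod g"
  have x: "x = g * t + m - g div 2" using mult_div_mod_eq[of g "x + g div 2"] by (simp add: t_def m_def)
  have m: "0 \<le> m" "m < g" using assms by (auto simp: m_def)
  have "g * \<bar>t\<bar> \<le> 2 * \<bar>x\<bar>"
  proof (cases "t = 0")
    case False
    have h: "2 * (g div 2) \<le> g" "g - 1 \<le> 2 * (g div 2)" by auto
    consider "1 \<le> t" | "t \<le> -1" using False by linarith
    then show ?thesis
    proof cases
      case 1
      then have "g * 1 \<le> g * t" using assms by (intro mult_left_mono) auto
      then have "g * t \<le> 2 * x" using x m h by linarith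
      then show ?thesis using 1 by simp
    next
      case 2
      then have "g * t \<le> g * (-1)" using assms by (intro mult_left_mono) auto
      then have "- (g * t) \<le> 2 * (- x)" using x m h by linarith
      then show ?thesis using 2 by (simp add: abs_if)
    qed
  qed auto
  then show ?thesis by (simp add: t_def)
qed

text \<open>Rounding \<open>w i / g\<close> to the nearest integer determines \<open>w\<close> within its residue class. In contrast to
  \<open>card_lattice_ball_class_le\<close>, no factor \<open>2 ^ k\<close> for the signs is lost, which is what matters
  when \<open>g\<close> exceeds the typical size of a coordinate.\<close>
lemma card_lattice_ball_class_le_contracted:
  assumes "1 \<le> q" "0 < k" "0 < g"
  shows "card {w \<in> lattice_ball dir q k R. \<forall>i<k. w i mod int g = a i mod int g}
           \<le> card (lattice_ball Undirected q k (2 * R / real g))"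
proof (rule card_inj_on_le)
  let ?X = "{w \<in> lattice_ball dir q k R. \<forall>i<k. w i mod int g = a i mod int g}"
  let ?f = "\<lambda>w::nat \<Rightarrow> int. restrict (\<lambda>i. (w i + int g div 2) div int g) {..<k}"
  show "inj_on ?f ?X"
  proof (rule inj_onI)
    fix u v assume u: "u \<in> ?X" and v: "v \<in> ?X" and eq: "?f u = ?f v"
    have "u i = v i" if i: "i < k" for i
    proof -
      have "(u i + int g div 2) div int g = (v i + int g div 2) div int g"
        using eq i by (simp add: restrict_eq_iff)
      moreover have "u i mod int g = v i mod int g" using u v i by auto
      then have "(u i + int g div 2) mod int g = (v i + int g div 2) mod int g"
        by (metis mod_add_left_eq)
      ultimately have "u i + int g div 2 = v i + int g div 2" by (metis div_mult_mod_eq)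
      then show ?thesis by simp
    qed
    then show "u = v"
      using u v by (intro PiE_ext[of u "{..<k}" "\<lambda>_. coords dir" v]) (auto simp: lattice_ball_def)
  qed
  show "?f ` ?X \<subseteq> lattice_ball Undirected q k (2 * R / real g)"
  proof
    fix y assume "y \<in> ?f ` ?X"
    then obtain w where w: "w \<in> lattice_ball dir q k R" and y: "y = ?f w" by blast
    have "lnorm q k (\<lambda>i. real_of_int ((w i + int g div 2) div int g)) \<le> (2 / real g) * R"
    proof (rule lnorm_le_mono[OF assms(1,2)])
      show "lnorm q k (\<lambda>i. (2 / real g) * real_of_int (w i)) \<le> (2 / real g) * R"
        using w assms by (intro lnorm_scale_le) (auto simp: lattice_ball_def)
      fix i
      have "int g * \<bar>(w i + int g div 2) div int g\<bar> \<le> 2 * \<bar>w i\<bar>"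
        using assms(3) by (intro rounded_quotient_bound) simp
      then have "real g * \<bar>real_of_int ((w i + int g div 2) div int g)\<bar> \<le> 2 * \<bar>real_of_int (w i)\<bar>"
        unfolding of_int_le_iff [symmetric, where 'a = real] by simp
      then show "\<bar>real_of_int ((w i + int g div 2) div int g)\<bar> \<le> \<bar>(2 / real g) * real_of_int (w i)\<bar>"
        using assms(3) by (simp add: field_simps abs_mult)
    qed
    then show "y \<in> lattice_ball Undirected q k (2 * R / real g)"
      unfolding y lattice_ball_def by (simp only: lnorm_restrict mem_Collect_eq) (auto simp: coords_def)
  qed
qed (rule finite_lattice_ball[OF assms(1)])

section \<open>Balls with few points per dimension\<close>

lemma sum_power_abs_le:
  fixes r :: real
  assumes "0 < r" "r < 1"
  shows "(\<Sum>j\<in>{- int m .. int m}. r ^ nat \<bar>j\<bar>) \<le> 1 + 2 * r / (1 - r)"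
proof -
  have "(\<Sum>j\<in>{- int m .. int m}. r ^ nat \<bar>j\<bar>) = 1 + 2 * (r - r ^ Suc m) / (1 - r)"
  proof (induction m)
    case (Suc m)
    have "{- int (Suc m) .. int (Suc m)} = insert (int (Suc m)) (insert (- int (Suc m)) {- int m .. int m})"
      by auto
    then have "(\<Sum>j\<in>{- int (Suc m) .. int (Suc m)}. r ^ nat \<bar>j\<bar>)
        = 2 * r ^ Suc m + (\<Sum>j\<in>{- int m .. int m}. r ^ nat \<bar>j\<bar>)"
      by (simp add: nat_add_distrib)
    then show ?case unfolding Suc.IH using assms by (simp add: field_simps)
  qed auto
  also have "\<dots> \<le> 1 + 2 * r / (1 - r)"
    using assms by (intro add_left_mono divide_right_mono) auto
  finally show ?thesis .
qed

text \<open>An exponential moment bound: every point of the ball has weight at least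
  \<open>r powr (\<sigma> * k)\<close> under the product weight \<open>r ^ \<bar>w i\<bar>\<close>.\<close>
lemma card_small_l1_le:
  fixes r \<sigma> :: real
  assumes "0 < r" "r < 1" "finite X" "X \<subseteq> {..<k} \<rightarrow>\<^sub>E UNIV"
    and sum: "\<And>w. w \<in> X \<Longrightarrow> (\<Sum>i<k. \<bar>real_of_int (w i)\<bar>) \<le> \<sigma> * real k"
  shows "real (card X) \<le> (r powr (- \<sigma>) * (1 + 2 * r / (1 - r))) ^ k"
proof -
  \<comment> \<open>No coordinate exceeds the bound on the sum, so the product weight can be summed
    over a finite box, where it factorises into geometric sums.\<close>
  define m where "m = nat \<lceil>\<sigma> * real k\<rceil>"
  define P where "P = ({..<k} \<rightarrow>\<^sub>E {- int m .. int m})"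
  have XP: "X \<subseteq> P"
  proof
    fix w assume w: "w \<in> X"
    have "w i \<in> {- int m .. int m}" if "i < k" for i
    proof -
      have "\<bar>real_of_int (w i)\<bar> \<le> (\<Sum>i<k. \<bar>real_of_int (w i)\<bar>)"
        using that by (intro member_le_sum) auto
      then have "\<bar>real_of_int (w i)\<bar> \<le> \<sigma> * real k" using sum[OF w] by linarith
      then have "\<bar>w i\<bar> \<le> int m" unfolding m_def by linarith
      then show ?thesis by auto
    qed
    then show "w \<in> P" using w assms(4) by (auto simp: P_def PiE_iff)
  qed
  have "real (card X) * (r powr \<sigma>) ^ k = (\<Sum>w\<in>X. r powr (\<sigma> * real k))"
    using assms by (simp add: powr_powr powr_realpow [symmetric])
  also have "\<dots> \<le> (\<Sum>w\<in>X. \<Prod>i<k. r ^ nat \<bar>w i\<bar>)"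
  proof (rule sum_mono)
    fix w assume w: "w \<in> X"
    have "r powr (\<sigma> * real k) \<le> r powr (\<Sum>i<k. \<bar>real_of_int (w i)\<bar>)"
      using sum[OF w] assms by (intro powr_mono') auto
    also have "\<dots> = (\<Prod>i<k. r powr \<bar>real_of_int (w i)\<bar>)"
      using assms by (intro powr_sum) auto
    also have "\<dots> = (\<Prod>i<k. r ^ nat \<bar>w i\<bar>)"
      using assms by (intro prod.cong) (auto simp: powr_realpow [symmetric])
    finally show "r powr (\<sigma> * real k) \<le> (\<Prod>i<k. r ^ nat \<bar>w i\<bar>)" .
  qed
  also have "\<dots> \<le> (\<Sum>w\<in>P. \<Prod>i<k. r ^ nat \<bar>w i\<bar>)"
    using XP assms by (intro sum_mono2) (auto simp: P_def intro!: finite_PiE prod_nonneg)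
  also have "\<dots> = (\<Prod>i<k. \<Sum>j\<in>{- int m .. int m}. r ^ nat \<bar>j\<bar>)"
    unfolding P_def by (rule prod_sum_PiE [symmetric]) auto
  also have "\<dots> \<le> (1 + 2 * r / (1 - r)) ^ k"
    using sum_power_abs_le[OF assms(1,2), of m]
    by (auto intro!: power_mono sum_nonneg simp: assms less_imp_le)
  finally have "real (card X) * (r powr \<sigma>) ^ k \<le> (1 + 2 * r / (1 - r)) ^ k" .
  then show ?thesis
    using assms(1) by (simp add: power_mult_distrib powr_minus field_simps)
qed

text \<open>Integers satisfy |x| <= |x| powr p, so a small ball for finite q has small l1 norm and
  \<open>card_small_l1_le\<close> applies. For q = \<infinity> a ball of radius 1 / 2 contains the
  origin only.\<close>

lemma card_small_lattice_ball:
  assumes "1 \<le> q" "0 < \<eta>"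
  obtains s where "0 < s"
    and "\<And>k. 0 < k \<Longrightarrow> real (card (lattice_ball Undirected q k (s * real k powr recip q))) \<le> exp (\<eta> * real k)"
proof -
  \<comment> \<open>r and \<sigma> are chosen such that the two factors in
    \<open>card_small_l1_le\<close> become 1 + \<eta> / 2 and exp (\<eta> / 2), whose product is at
    most exp \<eta>.\<close>
  define r where "r = \<eta> / (4 + \<eta>)"
  have r: "0 < r" "r < 1" "2 * r / (1 - r) = \<eta> / 2"
    using assms by (auto simp: r_def field_simps)
  define \<sigma> where "\<sigma> = \<eta> / 2 / (- ln r)"
  have \<sigma>: "0 < \<sigma>" "r powr (- \<sigma>) = exp (\<eta> / 2)"
    using r assms by (auto simp: \<sigma>_def powr_def divide_pos_neg)
  have key: "real (card (lattice_ball Undirected q k R)) \<le> exp (\<eta> * real k)"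
    if "\<And>w. w \<in> lattice_ball Undirected q k R \<Longrightarrow> (\<Sum>i<k. \<bar>real_of_int (w i)\<bar>) \<le> \<sigma> * real k" for k R
  proof -
    have "real (card (lattice_ball Undirected q k R)) \<le> (r powr (- \<sigma>) * (1 + 2 * r / (1 - r))) ^ k"
      by (rule card_small_l1_le[OF r(1,2) finite_lattice_ball[OF assms(1)] _ that])
        (auto simp: lattice_ball_def coords_def)
    also have "\<dots> \<le> (exp (\<eta> / 2) * exp (\<eta> / 2)) ^ k"
      unfolding r(3) \<sigma>(2) using assms by (intro power_mono mult_left_mono exp_ge_add_one_self) auto
    also have "\<dots> = exp (\<eta> * real k)"
      by (simp flip: exp_add exp_of_nat_mult add: mult.commute)
    finally show ?thesis .
  qed
  from assms(1) show ?thesis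
  proof (cases rule: exponent_cases)
    case (finite p)
    show ?thesis
    proof (rule that[of "\<sigma> powr (1 / p)"])
      fix k :: nat assume k: "0 < k"
      have R: "(\<sigma> powr (1 / p) * real k powr (1 / p)) powr p = \<sigma> * real k"
        using \<sigma> finite by (simp add: powr_mult powr_powr)
      show "real (card (lattice_ball Undirected q k (\<sigma> powr (1 / p) * real k powr recip q))) \<le> exp (\<eta> * real k)"
      proof (rule key)
        fix w assume w: "w \<in> lattice_ball Undirected q k (\<sigma> powr (1 / p) * real k powr recip q)"
        have "(\<Sum>i<k. \<bar>real_of_int (w i)\<bar>) \<le> (\<Sum>i<k. \<bar>real_of_int (w i)\<bar> powr p)"
        proof (rule sum_mono)
          fix i
          show "\<bar>real_of_int (w i)\<bar> \<le> \<bar>real_of_int (w i)\<bar> powr p"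
          proof (cases "w i = 0")
            case False
            then have "1 \<le> \<bar>real_of_int (w i)\<bar>" by linarith
            then show ?thesis using powr_mono[of 1 p "\<bar>real_of_int (w i)\<bar>"] finite by simp
          qed auto
        qed
        also have "\<dots> \<le> (\<sigma> powr (1 / p) * real k powr (1 / p)) powr p"
          using w finite by (simp add: lattice_ball_def lnorm_ereal_le_iff)
        finally show "(\<Sum>i<k. \<bar>real_of_int (w i)\<bar>) \<le> \<sigma> * real k" by (simp only: R)
      qed
    qed (use \<sigma> in auto)
  next
    case infinite
    show ?thesis
    proof (rule that[of "1 / 2"])
      fix k :: nat assume k: "0 < k"
      show "real (card (lattice_ball Undirected q k (1 / 2 * real k powr recip q))) \<le> exp (\<eta> * real k)"
      proof (rule key)
        fix w assume w: "w \<in> lattice_ball Undirected q k (1 / 2 * real k powr recip q)"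
        have "w i = 0" if "i < k" for i
        proof -
          have "\<bar>real_of_int (w i)\<bar> \<le> 1 / 2"
            using w infinite k that
            by (intro coordinate_le_lnorm[OF assms(1)]) (auto simp: lattice_ball_def)
          then show ?thesis by linarith
        qed
        then show "(\<Sum>i<k. \<bar>real_of_int (w i)\<bar>) \<le> \<sigma> * real k" using \<sigma> by simp
      qed
    qed auto
  qed
qed

section \<open>Volume of lattice balls\<close>

text \<open>For b = k / p and up to the factor \<open>orthant_volume (ereal p) k\<close>, this is
  the volume of the slice at height x of the set of nonnegative points in dimension k + 1 whose p-th
  powers sum to at most T. Beyond T powr (1 / p) the value is \<open>0 powr b = 0\<close>.\<close>

definition ball_section :: "real \<Rightarrow> real \<Rightarrow> real \<Rightarrow> real \<Rightarrow> real" where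
  "ball_section p b T x = max 0 (T - x powr p) powr b"

text \<open>The substitution t = x powr p / T turns the integral into the Beta integral with
  parameters 1 / p and b + 1. It is carried out on open intervals, away from the singularity of the
  Beta integrand at 0.\<close>

lemma has_integral_ball_section:
  fixes p b T :: real
  assumes p: "1 \<le> p" and b: "0 < b" and T: "0 < T" and n: "T powr (1 / p) \<le> n"
  shows "(ball_section p b T has_integral
           T powr (b + 1 / p) * (Gamma (1 + 1 / p) * Gamma (b + 1) / Gamma (b + 1 / p + 1))) {0..n}"
proof -
  define A where "A = T powr (1 / p)"
  have A: "0 < A" "A powr p = T" using p T by (auto simp: A_def powr_powr)
  let ?I = "T powr (b + 1 / p) * (Gamma (1 + 1 / p) * Gamma (b + 1) / Gamma (b + 1 / p + 1))"
  define f where "f t = t powr (1 / p - 1) * (1 - t) powr (b + 1 - 1)" for t :: real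
  define g where "g x = x powr p / T" for x :: real
  define g' where "g' x = p * x powr (p - 1) / T" for x :: real
  have less: "x powr p < T \<longleftrightarrow> x < A" if "0 < x" for x
    using powr_less_mono2[of p x A] powr_mono2[of p A x] that p A by (cases "x < A") auto
  have image: "g ` {0<..<A} = {0<..<1}"
  proof
    show "g ` {0<..<A} \<subseteq> {0<..<1}" using T less by (auto simp: g_def field_simps)
    show "{0<..<1} \<subseteq> g ` {0<..<A}"
    proof
      fix t :: real assume t: "t \<in> {0<..<1}"
      have "(T * t) powr (1 / p) < A" unfolding A_def using t T p by (intro powr_less_mono2) auto
      moreover have "g ((T * t) powr (1 / p)) = t" using t T p by (simp add: g_def powr_powr)
      ultimately show "t \<in> g ` {0<..<A}" using t T by (intro image_eqI[of _ _ "(T * t) powr (1 / p)"]) auto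
    qed
  qed
  have inj: "inj_on g {0<..<A}"
  proof (rule inj_onI)
    fix x y assume xy: "x \<in> {0<..<A}" "y \<in> {0<..<A}" and "g x = g y"
    then have "(x powr p) powr (1 / p) = (y powr p) powr (1 / p)" using T by (simp add: g_def)
    then show "x = y" using xy p by (simp add: powr_powr)
  qed
  have der: "(g has_field_derivative g' x) (at x within {0<..<A})" if "x \<in> {0<..<A}" for x
  proof -
    have "((\<lambda>x. x powr p) has_real_derivative p * x powr (p - 1)) (at x)"
      using that by (intro has_real_derivative_powr) auto
    then have "(g has_real_derivative p * x powr (p - 1) / T) (at x)"
      unfolding g_def by (rule DERIV_cdivide)
    then show ?thesis unfolding g'_def by (rule has_field_derivative_at_within)
  qed
  have f: "(f has_integral Beta (1 / p) (b + 1)) {0<..<1}"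
    using has_integral_Beta_real[of "1 / p" "b + 1"] p b unfolding f_def by (simp add: has_integral_Icc_iff_Ioo)
  have "f absolutely_integrable_on g ` {0<..<A} \<and> integral (g ` {0<..<A}) f = Beta (1 / p) (b + 1)"
    unfolding image using f
    by (auto simp: has_integral_iff f_def intro!: nonnegative_absolutely_integrable_1)
  then have "(\<lambda>x. \<bar>g' x\<bar> * f (g x)) absolutely_integrable_on {0<..<A} \<and>
      integral {0<..<A} (\<lambda>x. \<bar>g' x\<bar> * f (g x)) = Beta (1 / p) (b + 1)"
    using has_absolute_integral_change_of_variables_1'[OF _ der inj, of f "Beta (1 / p) (b + 1)"] by simp
  then have "((\<lambda>x. \<bar>g' x\<bar> * f (g x)) has_integral Beta (1 / p) (b + 1)) {0<..<A}"
    by (simp add: has_integral_iff absolutely_integrable_on_def)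
  then have "((\<lambda>x. (T powr (b + 1 / p) / p) * (\<bar>g' x\<bar> * f (g x))) has_integral
      (T powr (b + 1 / p) / p) * Beta (1 / p) (b + 1)) {0<..<A}"
    by (rule has_integral_mult_right)
  moreover have "(T powr (b + 1 / p) / p) * (\<bar>g' x\<bar> * f (g x)) = ball_section p b T x"
    if x: "x \<in> {0<..<A}" for x
  proof -
    have pos: "0 < T - x powr p" "0 < x" using x less by auto
    have 1: "(x powr p / T) powr (1 / p - 1) = x powr (1 - p) / T powr (1 / p - 1)"
      using p by (simp add: powr_divide powr_powr right_diff_distrib)
    have 2: "(1 - x powr p / T) powr b = (T - x powr p) powr b / T powr b"
      using T pos by (simp add: powr_divide [symmetric] field_simps)
    have 3: "x powr (p - 1) * x powr (1 - p) = 1"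
      using pos by (simp add: powr_add [symmetric])
    have 4: "T powr (b + 1 / p) = T * T powr (1 / p - 1) * T powr b"
      using T by (simp add: powr_add [symmetric] powr_mult_base add.commute)
    have 5: "\<bar>g' x\<bar> = p * x powr (p - 1) / T"
      using T p by (simp add: g'_def abs_mult)
    have "(T powr (b + 1 / p) / p) * (\<bar>g' x\<bar> * f (g x))
        = (T * T powr (1 / p - 1) * T powr b / p) *
          ((p * x powr (p - 1) / T) *
            (x powr (1 - p) / T powr (1 / p - 1) * ((T - x powr p) powr b / T powr b)))"
      unfolding 4 5 by (simp only: f_def g_def 1 2 add_diff_cancel_right')
    also have "\<dots> = (x powr (p - 1) * x powr (1 - p)) * (T - x powr p) powr b"
    proof -
      have cancel: "(T * d * e / p) * ((p * y / T) * (y' / d * (u / e))) = (y * y') * u"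
        if "d \<noteq> 0" "e \<noteq> 0" for d e y y' u :: real
        using that T p by simp
      show ?thesis using T by (intro cancel) auto
    qed
    finally show ?thesis unfolding 3 using pos by (simp add: ball_section_def)
  qed
  moreover have "(T powr (b + 1 / p) / p) * Beta (1 / p) (b + 1) = ?I"
  proof -
    have "Gamma (1 / p + 1) = 1 / p * Gamma (1 / p)"
      using p by (intro Gamma_plus1) (auto dest: nonpos_Ints_nonpos)
    then show ?thesis by (simp add: Beta_def add_ac)
  qed
  ultimately have "(ball_section p b T has_integral ?I) {0<..<A}"
    by (metis (no_types, lifting) has_integral_cong)
  then have "(ball_section p b T has_integral ?I) {0..A}"
    by (simp add: has_integral_Icc_iff_Ioo)
  moreover have "ball_section p b T x = 0" if "x \<in> {A..n}" for x
    using less[of x] that A b by (auto simp: ball_section_def max_def)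
  then have "(ball_section p b T has_integral 0) {A..n}"
    by (intro has_integral_is_0)
  ultimately have "(ball_section p b T has_integral (?I + 0)) {0..n}"
    using A n by (intro has_integral_combine[where c = A]) (auto simp: A_def)
  then show ?thesis by simp
qed

lemma antimono_ball_section:
  assumes "1 \<le> p" "0 < b"
  shows "antimono_fun_sum_integral_diff (ball_section p b T)"
proof
  show "ball_section p b T x \<ge> ball_section p b T y" if "x \<ge> 0" "x \<le> y" for x y
    using that assms unfolding ball_section_def
    by (intro powr_mono2 max.mono diff_left_mono order_refl) auto
  show "continuous_on {0..} (ball_section p b T)"
    unfolding ball_section_def using assms
    by (intro continuous_on_powr' continuous_intros) auto
qed (auto simp: ball_section_def)

text \<open>Integral test for a decreasing function: left endpoints overestimate and right endpoints
  underestimate the integral. This is where the start of the coordinates at 0 or at 1 decides the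
  direction of the bound.\<close>

lemma sum_ball_section_bounds:
  assumes "1 \<le> p" "0 < b" "0 < T" "T powr (1 / p) \<le> real n"
  defines "I \<equiv> T powr (b + 1 / p) * (Gamma (1 + 1 / p) * Gamma (b + 1) / Gamma (b + 1 / p + 1))"
  shows "I \<le> (\<Sum>j=0..n. ball_section p b T (real j))"
    and "(\<Sum>j=1..n. ball_section p b T (real j)) \<le> I"
proof -
  interpret antimono_fun_sum_integral_diff "ball_section p b T"
    by (rule antimono_ball_section[OF assms(1,2)])
  have I: "integral {0..real n} (ball_section p b T) = I"
    unfolding I_def by (intro integral_unique has_integral_ball_section assms)
  show "I \<le> (\<Sum>j=0..n. ball_section p b T (real j))"
    using sum_integral_diff_series_nonneg[of n] I
    by (simp add: sum_integral_diff_series_def atMost_atLeast0)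
  show "(\<Sum>j=1..n. ball_section p b T (real j)) \<le> I"
    using sum_integral_diff_series_antimono[of 0 n] I
    by (simp add: sum_integral_diff_series_def atMost_atLeast0 sum.atLeast_Suc_atMost)
qed

section \<open>Induction over the dimension\<close>

text \<open>An orthant ball parametrised by T = R powr p, so that fixing a coordinate j just
  replaces T by T - j powr p.\<close>

definition power_sum_points :: "nat \<Rightarrow> real \<Rightarrow> nat \<Rightarrow> real \<Rightarrow> (nat \<Rightarrow> nat) set" where
  "power_sum_points c p k T = {w \<in> {..<k} \<rightarrow>\<^sub>E {c..}. (\<Sum>i<k. real (w i) powr p) \<le> T}"

lemma power_sum_points_empty: "T < 0 \<Longrightarrow> power_sum_points c p k T = {}"
  unfolding power_sum_points_def by (smt (verit) Collect_empty_eq powr_ge_zero sum_nonneg)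

text \<open>Slicing by the last coordinate. Any n beyond T powr (1 / p) will do, because the slices
  at larger j have a negative parameter and are empty.\<close>

lemma card_power_sum_points_Suc:
  assumes p: "1 \<le> p" and T: "0 \<le> T" and n: "T powr (1 / p) \<le> real n"
  shows "card (power_sum_points c p (Suc k) T) = (\<Sum>j=c..n. card (power_sum_points c p k (T - real j powr p)))"
proof -
  have fin: "finite (power_sum_points c p k S)" if "0 \<le> S" for S k
  proof -
    have "S = (S powr (1 / p)) powr p" using p that by (simp add: powr_powr)
    then have "power_sum_points c p k S = orthant_ball c (ereal p) k (S powr (1 / p))"
      using p by (auto simp: power_sum_points_def orthant_ball_def lnorm_ereal_le_iff)
    then show ?thesis using p by (simp add: finite_orthant_ball)
  qed
  let ?f = "\<lambda>(j, w). w(k := j)"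
  let ?S = "SIGMA j : {c..n}. power_sum_points c p k (T - real j powr p)"
  have "bij_betw ?f ?S (power_sum_points c p (Suc k) T)"
  proof (rule bij_betwI[where g = "\<lambda>w. (w k, restrict w {..<k})"])
    show "?f \<in> ?S \<rightarrow> power_sum_points c p (Suc k) T"
      by (auto simp: power_sum_points_def PiE_iff extensional_def)
    show "(\<lambda>w. (w k, restrict w {..<k})) \<in> power_sum_points c p (Suc k) T \<rightarrow> ?S"
    proof
      fix w assume w: "w \<in> power_sum_points c p (Suc k) T"
      then have sum: "(\<Sum>i<k. real (w i) powr p) + real (w k) powr p \<le> T"
        by (simp add: power_sum_points_def)
      moreover have "0 \<le> (\<Sum>i<k. real (w i) powr p)" by (intro sum_nonneg) auto
      ultimately have "real (w k) powr p \<le> T" by linarith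
      then have "(real (w k) powr p) powr (1 / p) \<le> T powr (1 / p)" using p by (intro powr_mono2) auto
      then have "real (w k) \<le> real n" using n p by (simp add: powr_powr)
      then show "(w k, restrict w {..<k}) \<in> ?S"
        using w sum by (auto simp: power_sum_points_def PiE_iff)
    qed
    show "(case ?f x of w \<Rightarrow> (w k, restrict w {..<k})) = x" if "x \<in> ?S" for x
      using that by (auto simp: power_sum_points_def PiE_iff extensional_def fun_eq_iff restrict_def)
    show "?f (y k, restrict y {..<k}) = y" if "y \<in> power_sum_points c p (Suc k) T" for y
      using that by (auto simp: power_sum_points_def PiE_iff extensional_def fun_eq_iff restrict_def)
  qed
  then have "card (power_sum_points c p (Suc k) T) = card ?S"
    by (simp add: bij_betw_same_card)
  also have "\<dots> = (\<Sum>j=c..n. card (power_sum_points c p k (T - real j powr p)))"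
  proof (rule card_SigmaI)
    show "\<forall>j\<in>{c..n}. finite (power_sum_points c p k (T - real j powr p))"
      using fin by (metis finite.emptyI not_less power_sum_points_empty)
  qed auto
  finally show ?thesis .
qed

text \<open>Dirichlet's formula for the volume of the part of the unit ball in the nonnegative
  orthant, which for q = \<infinity> is the unit cube.\<close>

definition orthant_volume :: "ereal \<Rightarrow> nat \<Rightarrow> real" where
  "orthant_volume q k = (if q = \<infinity> then 1 else
     Gamma (1 + 1 / real_of_ereal q) ^ k / Gamma (real k / real_of_ereal q + 1))"

lemma orthant_volume_pos:
  assumes "1 \<le> q"
  shows "0 < orthant_volume q k"
  using assms
proof (cases rule: exponent_cases)
  case (finite p)
  then show ?thesis by (auto simp: orthant_volume_def intro!: divide_pos_pos zero_less_power Gamma_real_pos add_nonneg_pos)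
qed (simp add: orthant_volume_def)

text \<open>The factor is the constant of \<open>sum_ball_section_bounds\<close> for b = k / p:
  integrating the slices carries the volume to the next dimension.\<close>

lemma orthant_volume_Suc:
  assumes "1 \<le> p"
  shows "orthant_volume (ereal p) (Suc k) = orthant_volume (ereal p) k *
    (Gamma (1 + 1 / p) * Gamma (real k / p + 1) / Gamma (real k / p + 1 / p + 1))"
proof -
  have "Gamma (real k / p + 1) \<noteq> 0"
    using assms by (intro less_imp_neq[symmetric] Gamma_real_pos) (auto intro: add_nonneg_pos)
  then show ?thesis
    by (simp add: orthant_volume_def add_divide_distrib add_ac)
qed

text \<open>The induction hypothesis replaces each slice by its volume, and the integral test
  replaces the sum of the slices by their integral.\<close>

lemma card_power_sum_points_bounds:
  assumes p: "1 \<le> p" and T: "0 \<le> T" and k: "0 < k"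
  shows "orthant_volume (ereal p) k * T powr (real k / p) \<le> real (card (power_sum_points 0 p k T))"
    and "real (card (power_sum_points 1 p k T)) \<le> orthant_volume (ereal p) k * T powr (real k / p)"
proof -
  have "orthant_volume (ereal p) k * T powr (real k / p) \<le> real (card (power_sum_points 0 p k T)) \<and>
    real (card (power_sum_points 1 p k T)) \<le> orthant_volume (ereal p) k * T powr (real k / p)"
    using k T
  proof (induction k arbitrary: T rule: nat_induct_non_zero)
    case 1
    \<comment> \<open>The induction starts in dimension 1, since the integral test requires b > 0.
      The points are counted directly; there are n + 1 - c of them.\<close>
    define n where "n = nat \<lfloor>T powr (1 / p)\<rfloor>"
    have "Gamma (1 + 1 / p) \<noteq> 0"
      using p by (intro less_imp_neq[symmetric] Gamma_real_pos) (auto intro: add_nonneg_pos)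
    then have v: "orthant_volume (ereal p) (Suc 0) = 1"
      by (simp add: orthant_volume_def add.commute)
    have pts: "power_sum_points c p 0 (T - real j powr p) = (if real j powr p \<le> T then {\<lambda>_. undefined} else {})"
      for c j by (auto simp: power_sum_points_def)
    have le: "real j powr p \<le> T \<longleftrightarrow> j \<le> n" for j
    proof -
      have "real j powr p \<le> T \<longleftrightarrow> real j \<le> T powr (1 / p)"
        using p 1 powr_mono2[of "1 / p" "real j powr p" T] powr_mono2[of p "real j" "T powr (1 / p)"]
        by (auto simp: powr_powr)
      then show ?thesis by (simp add: n_def le_nat_floor le_floor_iff nat_le_iff nat_floor_neg)
         (metis le_nat_floor le_nat_iff le_floor_iff of_int_of_nat_eq powr_ge_zero zero_le_floor)
    qed
    have card: "card (power_sum_points c p (Suc 0) T) = Suc n - c" for c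
    proof -
      \<comment> \<open>Slicing asks for an upper bound of T powr (1 / p), hence
        \<open>Suc n\<close>; the additional slice is empty.\<close>
      have "T powr (1 / p) \<le> real (Suc n)" unfolding n_def by linarith
      then have "card (power_sum_points c p (Suc 0) T) =
          (\<Sum>j=c..Suc n. card (power_sum_points c p 0 (T - real j powr p)))"
        by (rule card_power_sum_points_Suc[OF p 1])
      also have "\<dots> = (\<Sum>j=c..Suc n. if j \<le> n then 1 else 0)"
        by (intro sum.cong refl) (simp add: pts le)
      also have "\<dots> = card {j \<in> {c..Suc n}. j \<le> n}"
        by (subst sum.inter_filter [symmetric]) auto
      also have "{j \<in> {c..Suc n}. j \<le> n} = {c..n}" by auto
      finally show ?thesis by simp
    qed
    have "real n \<le> T powr (1 / p)" "T powr (1 / p) \<le> real (Suc n)"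
      by (auto simp: n_def) linarith
    then show ?case by (simp add: card v)
  next
    case (Suc k)
    show ?case
    proof (cases "T = 0")
      \<comment> \<open>The integral test requires T > 0. For T = 0 both bounds are 0, and positive
        coordinates cannot have power sum 0.\<close>
      case True
      have "power_sum_points 1 p (Suc k) 0 = {}"
      proof (rule ccontr)
        assume "power_sum_points 1 p (Suc k) 0 \<noteq> {}"
        then obtain w where w: "w \<in> {..<Suc k} \<rightarrow>\<^sub>E {1..}" "(\<Sum>i<Suc k. real (w i) powr p) \<le> 0"
          by (auto simp: power_sum_points_def)
        have "0 < real (w k) powr p" using w PiE_mem[of w "{..<Suc k}" "\<lambda>_. {1..}" k] by auto
        moreover have "real (w k) powr p \<le> (\<Sum>i<Suc k. real (w i) powr p)"
          by (intro member_le_sum) auto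
        ultimately show False using w by linarith
      qed
      then show ?thesis using True by simp
    next
      case False
      then have T: "0 < T" using Suc.prems by simp
      define n where "n = nat \<lceil>T powr (1 / p)\<rceil>"
      have n: "T powr (1 / p) \<le> real n" by (simp add: n_def)
      have b: "0 < real k / p" using p Suc.hyps by simp
      note bounds = sum_ball_section_bounds[OF p b T n]
      have e: "real k / p + 1 / p = real (Suc k) / p" by (simp add: add_divide_distrib add.commute)
      let ?v = "orthant_volume (ereal p) k"
      have v: "0 \<le> ?v" using orthant_volume_pos[of "ereal p" k] p by simp
      \<comment> \<open>If T - j powr p is negative, the slice is empty and
        \<open>ball_section\<close> is 0, so the induction hypothesis is applied to nonnegative
        parameters only.\<close>
      have terms: "?v * ball_section p (real k / p) T (real j)
            \<le> real (card (power_sum_points 0 p k (T - real j powr p)))"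
          "real (card (power_sum_points 1 p k (T - real j powr p)))
            \<le> ?v * ball_section p (real k / p) T (real j)" for j
        using Suc.IH[of "T - real j powr p"] b power_sum_points_empty[of "T - real j powr p"] v
        by (cases "0 \<le> T - real j powr p"; simp add: ball_section_def)+
      have "?v * (\<Sum>j=0..n. ball_section p (real k / p) T (real j)) \<le> real (card (power_sum_points 0 p (Suc k) T))"
        unfolding card_power_sum_points_Suc[OF p Suc.prems n] sum_distrib_left of_nat_sum
        by (intro sum_mono terms)
      moreover have "real (card (power_sum_points 1 p (Suc k) T)) \<le> ?v * (\<Sum>j=1..n. ball_section p (real k / p) T (real j))"
        unfolding card_power_sum_points_Suc[OF p Suc.prems n] sum_distrib_left of_nat_sum
        by (intro sum_mono terms)
      moreover note mult_left_mono[OF bounds(1) v] mult_left_mono[OF bounds(2) v]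
      ultimately show ?thesis
        unfolding e orthant_volume_Suc[OF p] by (simp add: e mult_ac)
    qed
  qed
  then show "orthant_volume (ereal p) k * T powr (real k / p) \<le> real (card (power_sum_points 0 p k T))"
    and "real (card (power_sum_points 1 p k T)) \<le> orthant_volume (ereal p) k * T powr (real k / p)"
    by auto
qed

lemma card_orthant_ball_bounds:
  assumes q: "1 \<le> q" and k: "0 < k" and R: "0 < R"
  shows "orthant_volume q k * R ^ k \<le> real (card (orthant_ball 0 q k R))"
    and "real (card (orthant_ball 1 q k R)) \<le> orthant_volume q k * R ^ k"
proof -
  have "orthant_volume q k * R ^ k \<le> real (card (orthant_ball 0 q k R)) \<and>
    real (card (orthant_ball 1 q k R)) \<le> orthant_volume q k * R ^ k"
    using q
  proof (cases rule: exponent_cases)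
    case (finite p)
    have "orthant_ball c q k R = power_sum_points c p k (R powr p)" for c
      using finite R by (auto simp: power_sum_points_def orthant_ball_def lnorm_ereal_le_iff)
    moreover have "(R powr p) powr (real k / p) = R ^ k"
      using finite R by (simp add: powr_powr powr_realpow)
    ultimately show ?thesis
      using card_power_sum_points_bounds[OF finite(2) _ k, of "R powr p"] finite by simp
  next
    case infinite
    have eq: "orthant_ball c q k R = {..<k} \<rightarrow>\<^sub>E {c..nat \<lfloor>R\<rfloor>}" for c
    proof -
      have "real x \<le> R \<longleftrightarrow> x \<le> nat \<lfloor>R\<rfloor>" for x using R by linarith
      then show ?thesis
        using infinite k by (auto simp: orthant_ball_def lnorm_infty_le_iff PiE_iff extensional_def)
    qed
    have "R ^ k \<le> real (Suc (nat \<lfloor>R\<rfloor>)) ^ k" "real (nat \<lfloor>R\<rfloor>) ^ k \<le> R ^ k"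
      using R by (intro power_mono; linarith)+
    then show ?thesis unfolding eq using infinite by (simp add: card_PiE orthant_volume_def)
  qed
  then show "orthant_volume q k * R ^ k \<le> real (card (orthant_ball 0 q k R))"
    and "real (card (orthant_ball 1 q k R)) \<le> orthant_volume q k * R ^ k"
    by auto
qed

section \<open>Stirling's formula and the origin of the constant C\<close>

text \<open>The induction step amounts to n * ln (1 + 1 / n) <= 1. Crude bounds suffice: only ln
  (Gamma (x + 1)) / x matters, where errors of order ln x vanish in the limit.\<close>

lemma ln_fact_ge: "real n * ln (real n) - real n \<le> ln (fact n)"
proof (induction n)
  case (Suc n)
  show ?case
  proof (cases "n = 0")
    case False
    have "ln (1 + 1 / real n) \<le> 1 / real n" by (intro ln_add_one_self_le_self) simp
    moreover have "ln (1 + 1 / real n) = ln (real (Suc n)) - ln (real n)"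
    proof -
      have "1 + 1 / real n = real (Suc n) / real n" using False by (simp add: field_simps)
      then show ?thesis using False by (simp add: ln_div del: of_nat_Suc)
    qed
    ultimately have "real n * (ln (real (Suc n)) - ln (real n)) \<le> 1"
      using False by (simp add: mult.commute pos_le_divide_eq)
    then have "real n * ln (real (Suc n)) \<le> real n * ln (real n) + 1"
      by (simp add: right_diff_distrib)
    moreover have "ln (fact (Suc n) :: real) = ln (real (Suc n)) + ln (fact n)"
      by (simp add: ln_mult del: of_nat_Suc)
    ultimately show ?thesis
      using Suc.IH by (simp add: algebra_simps)
  qed auto
qed auto

lemma ln_fact_le: "ln (fact n) \<le> (real n + 1) * ln (real n + 1) - real n"
proof (induction n)
  case (Suc n)
  define a b where "a = ln (real n + 1)" and "b = ln (real n + 2)"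
  have "ln ((real n + 1) / (real n + 2)) \<le> (real n + 1) / (real n + 2) - 1"
    by (intro ln_le_minus_one) auto
  then have "1 / (real n + 2) \<le> b - a" by (simp add: ln_div field_simps a_def b_def)
  then have "1 \<le> (real n + 2) * (b - a)" by (simp add: field_simps)
  moreover have "ln (fact (Suc n) :: real) = a + ln (fact n)"
    by (simp add: a_def ln_mult add.commute del: of_nat_Suc)
  moreover have "ln (fact n) \<le> (real n + 1) * a - real n"
    using Suc.IH by (simp add: a_def)
  ultimately have "ln (fact (Suc n) :: real) \<le> (real n + 2) * b - (real n + 1)"
    by (simp add: algebra_simps)
  then show ?case by (simp add: b_def add.commute)
qed auto

text \<open>Gamma (x + 1) lies between the factorials of m = floor x and of m + 1, because
  \<open>2 \<le> x\<close> keeps all arguments in the range where Gamma increases.\<close>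

lemma ln_Gamma_real_bounds:
  fixes x :: real
  assumes "2 \<le> x"
  shows "(x - 1) * ln (x - 1) - x \<le> ln (Gamma (x + 1))"
    and "ln (Gamma (x + 1)) \<le> (x + 2) * ln (x + 2) - x"
proof -
  define m where "m = nat \<lfloor>x\<rfloor>"
  have m: "real m \<le> x" "x < real m + 1" "2 \<le> m" using assms by (auto simp: m_def) linarith+
  have fm: "fact m = Gamma (real m + 1)" "fact (Suc m) = Gamma (real m + 2)"
    using Gamma_fact[of m, where 'a = real] Gamma_fact[of "Suc m", where 'a = real]
    by (simp_all add: add.commute)
  have "fact m \<le> Gamma (x + 1)"
  proof (cases "real m = x")
    case False
    then show ?thesis unfolding fm using m by (intro less_imp_le Gamma_real_strict_mono) auto
  qed (simp add: fm)
  then have "ln (fact m) \<le> ln (Gamma (x + 1))" by (intro ln_mono) auto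
  moreover have "(x - 1) * ln (x - 1) \<le> real m * ln (real m)"
    using m assms by (intro mult_mono) auto
  ultimately show "(x - 1) * ln (x - 1) - x \<le> ln (Gamma (x + 1))"
    using ln_fact_ge[of m] m by linarith
  have "Gamma (x + 1) \<le> fact (Suc m)"
    unfolding fm using m by (intro less_imp_le Gamma_real_strict_mono) auto
  then have "ln (Gamma (x + 1)) \<le> ln (fact (Suc m))"
    using assms by (intro ln_mono) (auto intro!: Gamma_real_pos)
  moreover have "(real (Suc m) + 1) * ln (real (Suc m) + 1) \<le> (x + 2) * ln (x + 2)"
    using m by (intro mult_mono) auto
  ultimately show "ln (Gamma (x + 1)) \<le> (x + 2) * ln (x + 2) - x"
    using ln_fact_le[of "Suc m"] m by linarith
qed

lemma ln_Gamma_real_asymp: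
  "((\<lambda>x::real. ln (Gamma (x + 1)) / x - ln x) \<longlongrightarrow> - 1) at_top"
proof (rule tendsto_sandwich)
  show "((\<lambda>x::real. ((x - 1) * ln (x - 1) - x) / x - ln x) \<longlongrightarrow> - 1) at_top"
    by real_asymp
  show "((\<lambda>x::real. ((x + 2) * ln (x + 2) - x) / x - ln x) \<longlongrightarrow> - 1) at_top"
    by real_asymp
  show "\<forall>\<^sub>F x::real in at_top. ((x - 1) * ln (x - 1) - x) / x - ln x \<le> ln (Gamma (x + 1)) / x - ln x"
    using eventually_ge_at_top[of 2]
    by eventually_elim (intro diff_right_mono divide_right_mono ln_Gamma_real_bounds, auto)
  show "\<forall>\<^sub>F x::real in at_top. ln (Gamma (x + 1)) / x - ln x \<le> ((x + 2) * ln (x + 2) - x) / x - ln x"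
    using eventually_ge_at_top[of 2]
    by eventually_elim (intro diff_right_mono divide_right_mono ln_Gamma_real_bounds, auto)
qed

text \<open>Put x = k / p. By Stirling, ln (Gamma (x + 1)) / x is ln x - 1 + o(1), and the ln k in
  it cancels against the factor k powr (1 / p). What remains is Gamma (1 + 1 / p) * (p * e) powr (1
  / p), which is where the constant C comes from.\<close>

lemma orthant_volume_asymp:
  assumes "1 \<le> q"
  shows "(\<lambda>k. orthant_volume q k powr (1 / real k) * real k powr recip q) \<longlonglongrightarrow> C_const Directed q"
  using assms
proof (cases rule: exponent_cases)
  case (finite p)
  define c where "c = Gamma (1 + 1 / p)"
  have c: "0 < c" using finite by (auto simp: c_def intro!: Gamma_real_pos add_pos_pos)
  have "((\<lambda>k. ln (Gamma (real k / p + 1)) / (real k / p) - ln (real k / p)) \<longlongrightarrow> - 1) sequentially"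
    by (rule filterlim_compose[OF ln_Gamma_real_asymp])
       (use finite in real_asymp)
  then have "(\<lambda>k. exp (ln c + (1 / p) * (ln p - (ln (Gamma (real k / p + 1)) / (real k / p) - ln (real k / p)))))
      \<longlonglongrightarrow> exp (ln c + (1 / p) * (ln p - (- 1)))"
    by (intro tendsto_intros)
  also have "exp (ln c + (1 / p) * (ln p - (- 1))) = C_const Directed q"
    using finite c by (simp add: C_const_def C_undirected_def exp_add powr_def c_def add.commute ln_mult)
  finally show ?thesis
  proof (rule Lim_transform_eventually)
    show "\<forall>\<^sub>F k in sequentially. exp (ln c + (1 / p) * (ln p - (ln (Gamma (real k / p + 1)) / (real k / p) - ln (real k / p))))
       = orthant_volume q k powr (1 / real k) * real k powr recip q"
      using eventually_gt_at_top[of 0]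
    proof eventually_elim
      case (elim k)
      have G: "0 < Gamma (real k / p + 1)"
        using finite by (intro Gamma_real_pos add_nonneg_pos) auto
      have "ln (orthant_volume q k powr (1 / real k) * real k powr recip q)
          = ln (orthant_volume q k) / real k + ln (real k) / p"
        using orthant_volume_pos[OF assms, of k] elim finite by (simp add: ln_mult ln_powr)
      also have "ln (orthant_volume q k) = real k * ln c - ln (Gamma (real k / p + 1))"
        using finite c G by (simp add: orthant_volume_def c_def [symmetric] ln_div ln_realpow)
      also have "\<dots> / real k + ln (real k) / p
          = ln c + (1 / p) * (ln p - (ln (Gamma (real k / p + 1)) / (real k / p) - ln (real k / p)))"
        using elim finite by (simp add: ln_div field_simps)
      finally show ?case
        using orthant_volume_pos[OF assms, of k] elim by (metis exp_ln mult_pos_pos powr_gt_zero of_nat_0_less_iff less_numeral_extra(3))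
    qed
  qed
next
  case infinite
  have "\<forall>\<^sub>F k in sequentially. 1 = orthant_volume q k powr (1 / real k) * real k powr recip q"
    using eventually_gt_at_top[of 0] by eventually_elim (simp add: infinite orthant_volume_def)
  moreover have "(\<lambda>_. 1) \<longlonglongrightarrow> C_const Directed q"
    by (simp add: infinite C_const_def C_undirected_def)
  ultimately show ?thesis by (rule Lim_transform_eventually[rotated])
qed

section \<open>Power products in Abelian groups\<close>

text \<open>This is w \<cdot> Z in multiplicative notation. The index set is arbitrary because a
  generating set indexed by itself occurs as well.\<close>

definition power_product :: "('a, 'c) monoid_scheme \<Rightarrow> 'i set \<Rightarrow> ('i \<Rightarrow> 'a) \<Rightarrow> ('i \<Rightarrow> int) \<Rightarrow> 'a" where
  "power_product G I z w = finprod G (\<lambda>i. z i [^]\<^bsub>G\<^esub> w i) I"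

definition power_image :: "('a, 'c) monoid_scheme \<Rightarrow> nat \<Rightarrow> 'a set" where
  "power_image G g = (\<lambda>x. x [^]\<^bsub>G\<^esub> int g) ` carrier G"

context comm_group
begin

lemma power_product_closed [simp]:
  "(\<And>i. i \<in> I \<Longrightarrow> z i \<in> carrier G) \<Longrightarrow> power_product G I z w \<in> carrier G"
  unfolding power_product_def by (intro finprod_closed) auto

lemma power_product_cong:
  assumes "\<And>i. i \<in> I \<Longrightarrow> z i \<in> carrier G" "\<And>i. i \<in> I \<Longrightarrow> z i = y i" "\<And>i. i \<in> I \<Longrightarrow> v i = w i"
  shows "power_product G I z v = power_product G I y w"
  unfolding power_product_def using assms by (intro finprod_cong') auto

lemma power_product_add:
  assumes "\<And>i. i \<in> I \<Longrightarrow> z i \<in> carrier G"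
  shows "power_product G I z (\<lambda>i. v i + w i) = power_product G I z v \<otimes> power_product G I z w"
proof -
  have "power_product G I z (\<lambda>i. v i + w i) = finprod G (\<lambda>i. z i [^] v i \<otimes> z i [^] w i) I"
    unfolding power_product_def using assms by (intro finprod_cong') (auto simp: int_pow_mult)
  also have "\<dots> = power_product G I z v \<otimes> power_product G I z w"
    unfolding power_product_def using assms by (intro finprod_multf) auto
  finally show ?thesis .
qed

lemma power_product_mult:
  assumes "\<And>i. i \<in> I \<Longrightarrow> z i \<in> carrier G" "\<And>i. i \<in> I \<Longrightarrow> y i \<in> carrier G"
  shows "power_product G I (\<lambda>i. z i \<otimes> y i) w = power_product G I z w \<otimes> power_product G I y w"
proof -
  have "power_product G I (\<lambda>i. z i \<otimes> y i) w = finprod G (\<lambda>i. z i [^] w i \<otimes> y i [^] w i) I"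
    unfolding power_product_def using assms
    by (intro finprod_cong') (auto simp: int_pow_mult_distrib m_comm)
  also have "\<dots> = power_product G I z w \<otimes> power_product G I y w"
    unfolding power_product_def using assms by (intro finprod_multf) auto
  finally show ?thesis .
qed

lemma power_product_eq_iff:
  assumes "\<And>i. i \<in> I \<Longrightarrow> z i \<in> carrier G"
  shows "power_product G I z v = power_product G I z w \<longleftrightarrow> power_product G I z (\<lambda>i. v i - w i) = \<one>"
proof -
  have "power_product G I z v = power_product G I z (\<lambda>i. v i - w i) \<otimes> power_product G I z w"
    using power_product_add[of I z "\<lambda>i. v i - w i" w] assms by simp
  then show ?thesis
    using assms by simp
qed

lemma power_product_zero:
  assumes "\<And>i. i \<in> I \<Longrightarrow> w i = 0"
  shows "power_product G I z w = \<one>"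
  unfolding power_product_def using assms by (intro finprod_one_eqI) auto

lemma power_product_empty [simp]: "power_product G {} z w = \<one>"
  by (rule power_product_zero) auto

lemma power_product_insert:
  assumes "finite I" "a \<notin> I" "\<And>i. i \<in> insert a I \<Longrightarrow> z i \<in> carrier G"
  shows "power_product G (insert a I) z w = z a [^] w a \<otimes> power_product G I z w"
  unfolding power_product_def using assms by (subst finprod_insert) auto

lemma power_product_single:
  assumes "finite I" "h \<in> I" "\<And>i. i \<in> I \<Longrightarrow> z i \<in> carrier G"
  shows "power_product G I z (\<lambda>i. if i = h then j else 0) = z h [^] j"
proof -
  have "power_product G I z (\<lambda>i. if i = h then j else 0)
      = power_product G (insert h (I - {h})) z (\<lambda>i. if i = h then j else 0)"
    using assms by (simp add: insert_absorb)
  also have "\<dots> = z h [^] j \<otimes> power_product G (I - {h}) z (\<lambda>i. if i = h then j else 0)"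
    using assms by (subst power_product_insert) auto
  also have "power_product G (I - {h}) z (\<lambda>i. if i = h then j else 0) = \<one>"
    by (rule power_product_zero) auto
  finally show ?thesis using assms by simp
qed

lemma power_product_same:
  assumes "finite I" "x \<in> carrier G"
  shows "power_product G I (\<lambda>i. x [^] u i) w = x [^] (\<Sum>i\<in>I. u i * w i)"
  using assms(1)
proof (induction I rule: finite_induct)
  case empty
  then show ?case by (simp add: power_product_zero)
next
  case (insert a I)
  then show ?case
    using assms by (simp add: power_product_insert int_pow_pow int_pow_mult)
qed

end

section \<open>Fibres of power products\<close>

lemma bezout_finite:
  fixes v :: "'i \<Rightarrow> int"
  assumes "finite I"
  shows "\<exists>u. (\<Sum>i\<in>I. u i * v i) = Gcd (v ` I)"
  using assms
proof (induction I rule: finite_induct)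
  case (insert a I)
  then obtain u where u: "(\<Sum>i\<in>I. u i * v i) = Gcd (v ` I)" by blast
  obtain s t where st: "s * v a + t * Gcd (v ` I) = gcd (v a) (Gcd (v ` I))"
    using bezout_int by blast
  define u' where "u' i = (if i = a then s else t * u i)" for i
  have "(\<Sum>i\<in>I. u' i * v i) = (\<Sum>i\<in>I. t * (u i * v i))"
    using insert.hyps by (intro sum.cong) (auto simp: u'_def)
  then have "(\<Sum>i\<in>insert a I. u' i * v i) = s * v a + t * Gcd (v ` I)"
    using insert.hyps u by (simp add: u'_def sum_distrib_left [symmetric])
  then show ?case using st by (intro exI[of _ u']) simp
qed auto

context comm_group
begin

text \<open>Bezout coefficients u of w provide the tuple of the x [^] u i, whose power product is x
  [^] g.\<close>

lemma power_image_subset_power_products: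
  assumes "finite I" "nat (Gcd (w ` I)) = g" "y \<in> power_image G g"
  shows "\<exists>z \<in> I \<rightarrow>\<^sub>E carrier G. power_product G I z w = y"
proof -
  obtain x where x: "x \<in> carrier G" "y = x [^] int g"
    using assms(3) by (auto simp: power_image_def)
  obtain u where "(\<Sum>i\<in>I. u i * w i) = Gcd (w ` I)"
    using bezout_finite[OF assms(1)] by blast
  then have "(\<Sum>i\<in>I. u i * w i) = int g" using assms(2) by auto
  then have "power_product G I (\<lambda>i. x [^] u i) w = y"
    using power_product_same[OF assms(1) x(1)] x by simp
  moreover have "power_product G I (\<lambda>i. x [^] u i) w = power_product G I (restrict (\<lambda>i. x [^] u i) I) w"
    using x by (intro power_product_cong) auto
  ultimately show ?thesis
    using x by (intro bexI[of _ "restrict (\<lambda>i. x [^] u i) I"]) auto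
qed

text \<open>Multiplying the kernel by preimages \<open>s y\<close> of the elements y of the power
  image yields disjoint subsets of the set of all tuples. Hence a uniform tuple Z satisfies Z
  \<cdot> w = 1 with probability at most 1 / card (power_image G g).\<close>

lemma card_power_product_kernel_le:
  assumes "finite (carrier G)" "finite I" "nat (Gcd (w ` I)) = g"
  shows "card {z \<in> I \<rightarrow>\<^sub>E carrier G. power_product G I z w = \<one>} * card (power_image G g)
          \<le> Coset.order G ^ card I"
proof -
  let ?K = "{z \<in> I \<rightarrow>\<^sub>E carrier G. power_product G I z w = \<one>}"
  define s where "s y = (SOME z. z \<in> I \<rightarrow>\<^sub>E carrier G \<and> power_product G I z w = y)" for y
  have s: "s y \<in> I \<rightarrow>\<^sub>E carrier G \<and> power_product G I (s y) w = y" if "y \<in> power_image G g" for y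
  proof -
    have "\<exists>z. z \<in> I \<rightarrow>\<^sub>E carrier G \<and> power_product G I z w = y"
      using power_image_subset_power_products[OF assms(2,3) that] by blast
    then show ?thesis unfolding s_def by (rule someI_ex)
  qed
  let ?f = "\<lambda>(z, y). restrict (\<lambda>i. z i \<otimes> s y i) I"
  have prod: "power_product G I (?f (z, y)) w = y" if "z \<in> ?K" "y \<in> power_image G g" for z y
  proof -
    have z: "z i \<in> carrier G" "s y i \<in> carrier G" if "i \<in> I" for i
      using that \<open>z \<in> ?K\<close> s[OF \<open>y \<in> power_image G g\<close>] by (auto simp: PiE_iff)
    have "power_product G I (?f (z, y)) w = power_product G I (\<lambda>i. z i \<otimes> s y i) w"
      using z by (intro power_product_cong) auto
    also have "\<dots> = power_product G I z w \<otimes> power_product G I (s y) w"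
      using z by (intro power_product_mult)
    also have "\<dots> = y"
      using that s[OF that(2)] power_product_closed[of I "s y" w] z by auto
    finally show ?thesis .
  qed
  have "inj_on ?f (?K \<times> power_image G g)"
  proof (rule inj_onI, clarify)
    fix z y z' y'
    assume z: "z \<in> I \<rightarrow>\<^sub>E carrier G" "power_product G I z w = \<one>" "z' \<in> I \<rightarrow>\<^sub>E carrier G" "power_product G I z' w = \<one>"
      and y: "y \<in> power_image G g" "y' \<in> power_image G g"
      and eq: "restrict (\<lambda>i. z i \<otimes> s y i) I = restrict (\<lambda>i. z' i \<otimes> s y' i) I"
    have yy: "y = y'" using prod[of z y] prod[of z' y'] z y eq by simp
    have "z i = z' i" if i: "i \<in> I" for i
    proof -
      have "z i \<otimes> s y i = z' i \<otimes> s y i" using eq i yy by (simp add: restrict_eq_iff)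
      moreover have "z i \<in> carrier G" "z' i \<in> carrier G" "s y i \<in> carrier G"
        using z s[OF y(1)] i by (auto simp: PiE_iff)
      ultimately show ?thesis by simp
    qed
    then show "z = z' \<and> y = y'"
      using z yy by (auto intro: PiE_ext)
  qed
  moreover have "?f ` (?K \<times> power_image G g) \<subseteq> I \<rightarrow>\<^sub>E carrier G"
  proof clarify
    fix z y assume "z \<in> I \<rightarrow>\<^sub>E carrier G" "y \<in> power_image G g"
    then show "restrict (\<lambda>i. z i \<otimes> s y i) I \<in> I \<rightarrow>\<^sub>E carrier G"
      using s[of y] by (auto simp: PiE_iff)
  qed
  ultimately have "card (?K \<times> power_image G g) \<le> card (I \<rightarrow>\<^sub>E carrier G)"
    using assms by (intro card_inj_on_le[of ?f]) (auto intro: finite_PiE)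
  then show ?thesis
    using assms by (simp add: card_cartesian_product card_PiE Coset.order_def)
qed

section \<open>Generating sets and the subgroup of g-th powers\<close>

lemma generate_subset_power_products:
  assumes "finite S" "S \<subseteq> carrier G"
  shows "generate G S \<subseteq> range (power_product G S (\<lambda>s. s))"
proof
  have single: "power_product G S (\<lambda>s. s) (\<lambda>i. if i = h then j else 0) = h [^] j" if "h \<in> S" for h j
    using that assms by (intro power_product_single) auto
  fix x assume "x \<in> generate G S"
  then show "x \<in> range (power_product G S (\<lambda>s. s))"
  proof (induction rule: generate.induct)
    case one
    have "power_product G S (\<lambda>s. s) (\<lambda>_. 0) = \<one>" by (rule power_product_zero) auto
    then show ?case by (metis rangeI)
  next
    case (incl h)
    then have "power_product G S (\<lambda>s. s) (\<lambda>i. if i = h then 1 else 0) = h"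
      using single[of h 1] assms by auto
    then show ?case by (metis rangeI)
  next
    case (inv h)
    then have "power_product G S (\<lambda>s. s) (\<lambda>i. if i = h then -1 else 0) = inv h"
      using single[of h "-1"] assms int_pow_neg[of h 1] by auto
    then show ?case by (metis rangeI)
  next
    case (eng h1 h2)
    then obtain a b where "h1 = power_product G S (\<lambda>s. s) a" "h2 = power_product G S (\<lambda>s. s) b"
      by blast
    then have "h1 \<otimes> h2 = power_product G S (\<lambda>s. s) (\<lambda>i. a i + b i)"
      using power_product_add[of S "\<lambda>s. s" a b, OF subsetD[OF assms(2)]] by simp
    then show ?case by blast
  qed
qed

lemma min_generators_witness:
  assumes "finite (carrier G)"
  obtains S where "S \<subseteq> carrier G" "finite S" "card S = min_generators G" "generate G S = carrier G"
proof -
  have "\<exists>n S. S \<subseteq> carrier G \<and> finite S \<and> card S = n \<and> generate G S = carrier G"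
    using assms generate_incl[of "carrier G"] generate.incl[of _ "carrier G" G] by blast
  from LeastI_ex[OF this] show ?thesis
    using that unfolding min_generators_def by blast
qed

text \<open>Division of the exponents of the generators by g leaves a product with exponents below
  g, times a g-th power. So at most g ^ d such products represent all cosets of the subgroup of g-th
  powers.\<close>

lemma order_le_power_image:
  assumes "finite (carrier G)" "0 < g"
  shows "Coset.order G \<le> g ^ min_generators G * card (power_image G g)"
proof -
  obtain S where S: "S \<subseteq> carrier G" "finite S" "card S = min_generators G" "generate G S = carrier G"
    using min_generators_witness[OF assms(1)] .
  let ?A = "(S \<rightarrow>\<^sub>E {0..<int g}) \<times> power_image G g"
  let ?f = "\<lambda>(a, y). power_product G S (\<lambda>s. s) a \<otimes> y"
  have "carrier G \<subseteq> ?f ` ?A"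
  proof
    fix x assume "x \<in> carrier G"
    then obtain a where x: "x = power_product G S (\<lambda>s. s) a"
      using generate_subset_power_products[OF S(2,1)] S(4) by blast
    define r where "r = restrict (\<lambda>i. a i mod int g) S"
    define b where "b i = a i div int g" for i
    have "x = power_product G S (\<lambda>s. s) (\<lambda>i. r i + b i * int g)"
      unfolding x using S by (intro power_product_cong) (auto simp: r_def b_def)
    also have "\<dots> = power_product G S (\<lambda>s. s) r \<otimes> power_product G S (\<lambda>s. s) (\<lambda>i. b i * int g)"
      using S by (intro power_product_add) auto
    also have "power_product G S (\<lambda>s. s) (\<lambda>i. b i * int g) = power_product G S (\<lambda>s. s) b [^] int g"
      using S(2,1)
    proof (induction S rule: finite_induct)
      case empty
      then show ?case by (simp add: power_product_zero)
    next
      case (insert s S)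
      have c: "i \<in> carrier G" if "i \<in> insert s S" for i
        using insert.prems that by blast
      have "power_product G S (\<lambda>s. s) b \<in> carrier G" using c by (intro power_product_closed) auto
      moreover have "power_product G (insert s S) (\<lambda>s. s) w = s [^] w s \<otimes> power_product G S (\<lambda>s. s) w" for w
        by (rule power_product_insert) (use insert.hyps c in auto)
      ultimately show ?case
        using insert.IH insert.prems
        by (simp add: int_pow_mult_distrib m_comm int_pow_pow)
    qed
    finally have "x = ?f (r, power_product G S (\<lambda>s. s) b [^] int g)" by simp
    moreover have "r \<in> S \<rightarrow>\<^sub>E {0..<int g}" using assms(2) by (auto simp: r_def)
    moreover have "power_product G S (\<lambda>s. s) b [^] int g \<in> power_image G g"
      unfolding power_image_def using S by (intro imageI power_product_closed) auto
    ultimately show "x \<in> ?f ` ?A" by blast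
  qed
  moreover have "finite ?A"
    using S(2) assms by (auto intro!: finite_PiE simp: power_image_def)
  ultimately have "card (carrier G) \<le> card ?A"
    by (meson surj_card_le)
  also have "card ?A = g ^ min_generators G * card (power_image G g)"
    using S by (simp add: card_cartesian_product card_PiE)
  finally show ?thesis by (simp add: Coset.order_def)
qed

lemma card_power_image_pos:
  assumes "finite (carrier G)"
  shows "0 < card (power_image G g)"
  using assms by (auto simp: power_image_def card_gt_0_iff)

lemma power_image_1: "power_image G 1 = carrier G"
  by (force simp: power_image_def)

end

text \<open>Cauchy-Schwarz for the fibre sizes of f: they add up to card B, and their squares to the
  number of collisions.\<close>

lemma card_squared_le_collisions:
  assumes "finite B"
  shows "card B ^ 2 \<le> card (f ` B) * card {(v, w) \<in> B \<times> B. f v = f w}"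
proof -
  have coll: "card {(v, w) \<in> B \<times> B. f v = f w} = (\<Sum>y\<in>f ` B. card {v \<in> B. f v = y} ^ 2)"
  proof -
    have "{(v, w) \<in> B \<times> B. f v = f w} = (\<Union>y\<in>f ` B. {v \<in> B. f v = y} \<times> {v \<in> B. f v = y})"
      by auto
    also have "card \<dots> = (\<Sum>y\<in>f ` B. card ({v \<in> B. f v = y} \<times> {v \<in> B. f v = y}))"
      using assms by (intro card_UN_disjoint) auto
    finally show ?thesis by (simp add: card_cartesian_product power2_eq_square)
  qed
  have "B = (\<Union>y\<in>f ` B. {v \<in> B. f v = y})" by auto
  then have "card B = (\<Sum>y\<in>f ` B. card {v \<in> B. f v = y})"
    using assms by (subst card_UN_disjoint [symmetric]) auto
  then have "real (card B) ^ 2 = (\<Sum>y\<in>f ` B. real (card {v \<in> B. f v = y})) ^ 2"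
    by simp
  also have "\<dots> \<le> (\<Sum>y\<in>f ` B. real (card {v \<in> B. f v = y}) ^ 2) * card (f ` B)"
    by (rule sum_squared_le_sum_of_squares)
  also have "\<dots> = real (card (f ` B) * card {(v, w) \<in> B \<times> B. f v = f w})"
    unfolding coll by (simp only: of_nat_mult of_nat_sum of_nat_power mult.commute)
  finally show ?thesis
    unfolding of_nat_power [symmetric] of_nat_le_iff .
qed

section \<open>Second moment of the collision number\<close>

context comm_group
begin

text \<open>The order of the quotient of \<open>G\<close> by its subgroup of \<open>g\<close>-th powers.\<close>
definition power_index :: "nat \<Rightarrow> real" where
  "power_index g = real (Coset.order G) / real (card (power_image G g))"

lemma power_index_nonneg: "0 \<le> power_index g"
  by (simp add: power_index_def)

lemma power_index_le_order:
  assumes "finite (carrier G)"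
  shows "power_index g \<le> real (Coset.order G)"
proof -
  have "1 \<le> real (card (power_image G g))"
    using card_power_image_pos[OF assms, of g] by linarith
  then have "real (Coset.order G) * 1 \<le> real (Coset.order G) * real (card (power_image G g))"
    by (intro mult_left_mono) auto
  then show ?thesis
    using card_power_image_pos[OF assms, of g] by (simp add: power_index_def divide_le_eq)
qed

lemma power_index_le_power:
  assumes "finite (carrier G)" "0 < g"
  shows "power_index g \<le> real g ^ min_generators G"
proof -
  have "real (Coset.order G) \<le> real g ^ min_generators G * real (card (power_image G g))"
    using order_le_power_image[OF assms] by (metis of_nat_le_iff of_nat_mult of_nat_power)
  then show ?thesis
    using card_power_image_pos[OF assms(1), of g] by (simp add: power_index_def divide_le_eq)
qed

text \<open>Besides v = w, which accounts for the term n, only g = gcd (v - w) matters: g = 1 gives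
  the summand 1, and g >= 2 divides a nonzero coordinate of v - w and is thus at most m. The sum
  runs over all g with v \<equiv> w (mod g), not just the gcd, because congruences can be counted by
  residue classes.\<close>

lemma card_coincidences_le:
  assumes fin: "finite (carrier G)"
    and vw: "v \<in> {..<k} \<rightarrow>\<^sub>E UNIV" "w \<in> {..<k} \<rightarrow>\<^sub>E UNIV"
    and bound: "\<And>i. i < k \<Longrightarrow> \<bar>v i - w i\<bar> \<le> int m"
  shows "real (Coset.order G) * real (card {z \<in> {..<k} \<rightarrow>\<^sub>E carrier G.
            power_product G {..<k} z v = power_product G {..<k} z w})
     \<le> real (Coset.order G) ^ k * (real (Coset.order G) * of_bool (v = w) + 1 +
          (\<Sum>g=2..m. power_index g * of_bool (\<forall>i<k. v i mod int g = w i mod int g)))"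
proof -
  define n where "n = Coset.order G"
  define N where "N = card {z \<in> {..<k} \<rightarrow>\<^sub>E carrier G. power_product G {..<k} z v = power_product G {..<k} z w}"
  define S where "S = (\<Sum>g=2..m. power_index g * of_bool (\<forall>i<k. v i mod int g = w i mod int g))"
  have S: "0 \<le> S" unfolding S_def by (intro sum_nonneg mult_nonneg_nonneg power_index_nonneg) auto
  have "real n * real N \<le> real n ^ k * (real n * of_bool (v = w) + 1 + S)"
  proof (cases "v = w")
    case True
    have "real N = real n ^ k"
      using True by (simp add: N_def n_def Coset.order_def card_PiE)
    then show ?thesis using True S by (simp add: mult_left_mono field_simps)
  next
    case False
    define g where "g = nat (Gcd ((\<lambda>i. v i - w i) ` {..<k}))"
    have g: "int g dvd v i - w i" if "i < k" for i
      unfolding g_def using that by auto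
    obtain i where i: "i < k" "v i \<noteq> w i"
      using False vw PiE_ext[of v "{..<k}" "\<lambda>_. UNIV" w] by auto
    have "g \<noteq> 0" using g[OF i(1)] i(2) by (intro notI) simp
    moreover have "int g \<le> int m"
      using dvd_imp_le_int[OF _ g[OF i(1)]] i bound[OF i(1)] by simp
    ultimately have gm: "1 \<le> g" "g \<le> m" by linarith+
    have "N = card {z \<in> {..<k} \<rightarrow>\<^sub>E carrier G. power_product G {..<k} z (\<lambda>i. v i - w i) = \<one>}"
      unfolding N_def
    proof (intro arg_cong[of _ _ card] Collect_cong conj_cong refl)
      fix z assume "z \<in> {..<k} \<rightarrow>\<^sub>E carrier G"
      then show "power_product G {..<k} z v = power_product G {..<k} z w \<longleftrightarrow>
          power_product G {..<k} z (\<lambda>i. v i - w i) = \<one>"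
        by (intro power_product_eq_iff) auto
    qed
    then have "N * card (power_image G g) \<le> n ^ k"
      using card_power_product_kernel_le[OF fin, of "{..<k}" "\<lambda>i. v i - w i" g]
      by (simp add: g_def n_def)
    then have "real N * real (card (power_image G g)) \<le> real n ^ k"
      by (metis of_nat_le_iff of_nat_mult of_nat_power)
    then have "real n * (real N * real (card (power_image G g))) \<le> real n * real n ^ k"
      by (intro mult_left_mono) auto
    then have "real n * real N \<le> real n ^ k * power_index g"
      using card_power_image_pos[OF fin, of g]
      by (simp add: power_index_def n_def [symmetric] field_simps)
    also have "power_index g \<le> 1 + S"
    proof (cases "g = 1")
      case True
      have "power_index 1 = 1"
        using card_power_image_pos[OF fin, of 1]
        unfolding power_index_def power_image_1 by (simp add: Coset.order_def)
      then show ?thesis using True S by simp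
    next
      case False
      have "\<forall>i<k. v i mod int g = w i mod int g"
        using g by (simp add: mod_eq_dvd_iff)
      then have "power_index g = power_index g * of_bool (\<forall>i<k. v i mod int g = w i mod int g)"
        by simp
      also have "\<dots> \<le> S"
        unfolding S_def using gm False
        by (intro member_le_sum mult_nonneg_nonneg power_index_nonneg) auto
      finally show ?thesis by simp
    qed
    finally show ?thesis using False by (simp add: mult_left_mono)
  qed
  then show ?thesis by (simp only: n_def N_def S_def)
qed

text \<open>After exchanging the sums, the w congruent to a fixed v form one residue class of B,
  counted by K; the sum over v then contributes the factor card B.\<close>

lemma sum_collisions_le:
  assumes fin: "finite (carrier G)" and B: "finite B" "B \<subseteq> {..<k} \<rightarrow>\<^sub>E UNIV"
    and bound: "\<And>v w i. v \<in> B \<Longrightarrow> w \<in> B \<Longrightarrow> i < k \<Longrightarrow> \<bar>v i - w i\<bar> \<le> int m"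
    and K: "\<And>a g. 2 \<le> g \<Longrightarrow> g \<le> m \<Longrightarrow> real (card {w \<in> B. \<forall>i<k. w i mod int g = a i mod int g}) \<le> K g"
  shows "real (Coset.order G) * (\<Sum>z\<in>{..<k} \<rightarrow>\<^sub>E carrier G.
            real (card {(v, w) \<in> B \<times> B. power_product G {..<k} z v = power_product G {..<k} z w}))
     \<le> real (Coset.order G) ^ k * (real (Coset.order G) * real (card B) + real (card B) ^ 2 +
          real (card B) * (\<Sum>g=2..m. power_index g * K g))"
proof -
  define n where "n = Coset.order G"
  let ?P = "{..<k} \<rightarrow>\<^sub>E carrier G"
  define E where "E z v w \<longleftrightarrow> power_product G {..<k} z v = power_product G {..<k} z w" for z v w
  have finP: "finite ?P" using fin by (auto intro: finite_PiE)
  have card_bool: "real (card {x \<in> A. Q x}) = (\<Sum>x\<in>A. of_bool (Q x))" if "finite A" for A :: "'x set" and Q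
    using that by (simp add: of_bool_def sum.If_cases Int_def)
  have "(\<Sum>z\<in>?P. real (card {(v, w) \<in> B \<times> B. E z v w})) = (\<Sum>z\<in>?P. \<Sum>v\<in>B. \<Sum>w\<in>B. of_bool (E z v w))"
  proof (rule sum.cong[OF refl])
    fix z
    have "{(v, w) \<in> B \<times> B. E z v w} = {x \<in> B \<times> B. E z (fst x) (snd x)}" by auto
    then show "real (card {(v, w) \<in> B \<times> B. E z v w}) = (\<Sum>v\<in>B. \<Sum>w\<in>B. of_bool (E z v w))"
      unfolding sum.cartesian_product using B
      by (simp only: card_bool finite_cartesian_product) (simp only: case_prod_unfold)
  qed
  also have "\<dots> = (\<Sum>v\<in>B. \<Sum>w\<in>B. \<Sum>z\<in>?P. of_bool (E z v w))"
    by (subst sum.swap, rule sum.cong[OF refl], rule sum.swap)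
  also have "\<dots> = (\<Sum>v\<in>B. \<Sum>w\<in>B. real (card {z \<in> ?P. E z v w}))"
    by (simp only: card_bool[OF finP])
  finally have "real n * (\<Sum>z\<in>?P. real (card {(v, w) \<in> B \<times> B. E z v w}))
      = (\<Sum>v\<in>B. \<Sum>w\<in>B. real n * real (card {z \<in> ?P. E z v w}))"
    by (simp add: sum_distrib_left)
  also have "\<dots> \<le> (\<Sum>v\<in>B. \<Sum>w\<in>B. real n ^ k * (real n * of_bool (v = w) + 1 +
          (\<Sum>g=2..m. power_index g * of_bool (\<forall>i<k. v i mod int g = w i mod int g))))"
    unfolding n_def E_def using B bound by (intro sum_mono card_coincidences_le fin) auto
  also have "\<dots> = real n ^ k * (real n * (\<Sum>v\<in>B. \<Sum>w\<in>B. of_bool (v = w)) + real (card B) ^ 2 +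
      (\<Sum>v\<in>B. \<Sum>w\<in>B. \<Sum>g=2..m. power_index g * of_bool (\<forall>i<k. v i mod int g = w i mod int g)))"
    by (simp add: sum_distrib_left [symmetric] sum.distrib power2_eq_square)
  also have "(\<Sum>v\<in>B. \<Sum>w\<in>B. of_bool (v = w)) = real (card B)"
    using B by (simp add: of_bool_def)
  also have "(\<Sum>v\<in>B. \<Sum>w\<in>B. \<Sum>g=2..m. power_index g * of_bool (\<forall>i<k. v i mod int g = w i mod int g))
      = (\<Sum>v\<in>B. \<Sum>g=2..m. power_index g * real (card {w \<in> B. \<forall>i<k. w i mod int g = v i mod int g}))"
    unfolding card_bool[OF B(1)] sum_distrib_left
    by (rule sum.cong[OF refl], subst sum.swap, intro sum.cong refl) (simp add: eq_commute)
  also have "\<dots> \<le> (\<Sum>v\<in>B. \<Sum>g=2..m. power_index g * K g)"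
    by (intro sum_mono mult_left_mono K power_index_nonneg) auto
  finally show ?thesis
    by (simp add: n_def E_def mult_left_mono)
qed

text \<open>Markov's inequality for X - 1, with X z the normalised number of collisions. X >= 1 for
  every tuple, since the image lies in G, and Cauchy-Schwarz gives X >= 1 / \<beta> if the image is
  small. The leading term of \<open>sum_collisions_le\<close> cancels against the subtracted
  1.\<close>

lemma card_small_image_le:
  assumes fin: "finite (carrier G)" and B: "finite B" "B \<subseteq> {..<k} \<rightarrow>\<^sub>E UNIV" "B \<noteq> {}"
    and bound: "\<And>v w i. v \<in> B \<Longrightarrow> w \<in> B \<Longrightarrow> i < k \<Longrightarrow> \<bar>v i - w i\<bar> \<le> int m"
    and K: "\<And>a g. 2 \<le> g \<Longrightarrow> g \<le> m \<Longrightarrow> real (card {w \<in> B. \<forall>i<k. w i mod int g = a i mod int g}) \<le> K g"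
    and \<beta>: "0 < \<beta>" "\<beta> < 1"
  shows "real (card {z \<in> {..<k} \<rightarrow>\<^sub>E carrier G.
              real (card (power_product G {..<k} z ` B)) < \<beta> * real (Coset.order G)}) * (1 / \<beta> - 1)
     \<le> real (Coset.order G) ^ k * (real (Coset.order G) / real (card B) +
          (\<Sum>g=2..m. power_index g * K g) / real (card B))"
proof -
  define n where "n = Coset.order G"
  define b where "b = real (card B)"
  let ?P = "{..<k} \<rightarrow>\<^sub>E carrier G"
  define coll where "coll z = real (card {(v, w) \<in> B \<times> B. power_product G {..<k} z v = power_product G {..<k} z w})" for z
  define X where "X z = real n * coll z / b ^ 2" for z
  let ?bad = "{z \<in> ?P. real (card (power_product G {..<k} z ` B)) < \<beta> * real n}"
  have b: "0 < b" using B by (simp add: b_def card_gt_0_iff)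
  have n: "0 < n" using fin by (auto simp: n_def Coset.order_def card_gt_0_iff)
  have finP: "finite ?P" using fin by (auto intro: finite_PiE)
  have cardP: "real (card ?P) = real n ^ k" by (simp add: card_PiE n_def Coset.order_def)
  have cs: "b ^ 2 \<le> real (card (power_product G {..<k} z ` B)) * coll z" for z
    using card_squared_le_collisions[OF B(1), of "power_product G {..<k} z"]
    unfolding b_def coll_def of_nat_mult [symmetric] of_nat_power [symmetric] of_nat_le_iff .
  have coll: "0 \<le> coll z" for z by (simp add: coll_def)
  have X1: "1 \<le> X z" if "z \<in> ?P" for z
  proof -
    have "power_product G {..<k} z ` B \<subseteq> carrier G" using that by (auto intro!: power_product_closed)
    then have "real (card (power_product G {..<k} z ` B)) \<le> real n"
      using fin by (simp add: n_def Coset.order_def card_mono)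
    from order_trans[OF cs mult_right_mono[OF this coll]] have "b ^ 2 \<le> real n * coll z" .
    then show ?thesis using b by (simp add: X_def)
  qed
  have X2: "1 / \<beta> \<le> X z" if "z \<in> ?bad" for z
  proof -
    have "real (card (power_product G {..<k} z ` B)) \<le> \<beta> * real n" using that by simp
    from order_trans[OF cs mult_right_mono[OF this coll]] have "b ^ 2 \<le> (\<beta> * real n) * coll z" .
    then show ?thesis using b \<beta> by (simp add: X_def field_simps)
  qed
  have "real (card ?bad) * (1 / \<beta> - 1) = (\<Sum>z\<in>?bad. 1 / \<beta> - 1)" by simp
  also have "\<dots> \<le> (\<Sum>z\<in>?bad. X z - 1)" by (intro sum_mono diff_right_mono X2)
  also have "\<dots> \<le> (\<Sum>z\<in>?P. X z - 1)"
    using X1 finP by (intro sum_mono2) (auto simp: algebra_simps)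
  also have "\<dots> = real n * (\<Sum>z\<in>?P. coll z) / b ^ 2 - real n ^ k"
    by (simp add: sum_subtractf cardP X_def sum_distrib_left sum_divide_distrib)
  also have "\<dots> \<le> real n ^ k * (real n * b + b ^ 2 + b * (\<Sum>g=2..m. power_index g * K g)) / b ^ 2 - real n ^ k"
  proof (intro diff_right_mono divide_right_mono)
    show "real n * (\<Sum>z\<in>?P. coll z) \<le> real n ^ k * (real n * b + b ^ 2 + b * (\<Sum>g=2..m. power_index g * K g))"
      unfolding n_def b_def coll_def
      by (rule sum_collisions_le) (fact fin, fact B(1), fact B(2), erule (2) bound, erule (1) K)
  qed auto
  also have "\<dots> = real n ^ k * (real n / b + (\<Sum>g=2..m. power_index g * K g) / b)"
    using b by (simp add: field_simps power2_eq_square)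
  finally show ?thesis unfolding n_def b_def .
qed

end

section \<open>Cayley graphs\<close>

definition net_uses :: "('a \<times> nat \<times> bool) list \<Rightarrow> nat \<Rightarrow> int" where
  "net_uses p i = int (uses p i True) - int (uses p i False)"

lemma uses_Nil [simp]: "uses [] i s = 0"
  by (simp add: uses_def)

lemma uses_Cons: "uses (e # p) i s = uses p i s + (if snd e = (i, s) then 1 else 0)"
  by (simp add: uses_def)

lemma net_uses_Cons:
  "net_uses ((x, h, s) # p) i = (if i = h then if s then 1 else -1 else 0) + net_uses p i"
  by (simp add: net_uses_def uses_Cons)

lemma (in comm_group) cayley_awalk_end:
  assumes "pre_digraph.awalk (cayley_graph dir G k z) u p x" "\<And>i. i < k \<Longrightarrow> z i \<in> carrier G"
  shows "x = u \<otimes> power_product G {..<k} z (net_uses p)"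
  using assms(1)
proof (induction p arbitrary: u)
  case Nil
  then have "u \<in> carrier G" "x = u"
    by (auto simp: pre_digraph.awalk_def pre_digraph.cas.simps cayley_graph_def)
  moreover have "power_product G {..<k} z (net_uses ([] :: ('a \<times> nat \<times> bool) list)) = \<one>"
    by (rule power_product_zero) (simp add: net_uses_def)
  ultimately show ?case by auto
next
  case (Cons e p)
  obtain y h s where e: "e = (y, h, s)" by (cases e) auto
  define u' where "u' = (if s then u \<otimes> z h else u \<otimes> inv z h)"
  have u: "u \<in> carrier G" "h < k"
    and walk: "pre_digraph.awalk (cayley_graph dir G k z) u' p x"
    using Cons.prems assms(2)[of h] unfolding u'_def
    by (auto simp: pre_digraph.awalk_def pre_digraph.cas.simps cayley_graph_def e)
  let ?j = "if s then 1 else -1 :: int"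
  have step: "u' = u \<otimes> z h [^] ?j"
    using u assms(2)[of h] int_pow_neg[of "z h" 1] by (simp add: u'_def)
  have "x = u' \<otimes> power_product G {..<k} z (net_uses p)" by (rule Cons.IH[OF walk])
  also have "\<dots> = u \<otimes> (z h [^] ?j \<otimes> power_product G {..<k} z (net_uses p))"
    unfolding step using u assms(2) by (intro m_assoc power_product_closed) auto
  also have "z h [^] ?j = power_product G {..<k} z (\<lambda>i. if i = h then ?j else 0)"
    using u assms(2) by (intro power_product_single [symmetric]) auto
  also have "\<dots> \<otimes> power_product G {..<k} z (net_uses p)
      = power_product G {..<k} z (\<lambda>i. (if i = h then ?j else 0) + net_uses p i)"
    using assms(2) by (intro power_product_add [symmetric]) auto
  also have "(\<lambda>i. (if i = h then ?j else 0) + net_uses p i) = net_uses (e # p)"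
    by (auto simp: e net_uses_Cons)
  finally show ?case .
qed

lemma net_uses_coords:
  assumes "pre_digraph.awalk (cayley_graph dir G k z) u p x"
  shows "net_uses p i \<in> coords dir"
proof (cases dir)
  case Directed
  have "set p \<subseteq> carrier G \<times> {..<k} \<times> {True}"
    using assms Directed by (simp add: pre_digraph.awalk_def cayley_graph_def)
  then have "(i, False) \<notin> set (map snd p)" by auto
  then have "uses p i False = 0" unfolding uses_def by (simp add: count_list_0_iff)
  then show ?thesis using Directed by (simp add: net_uses_def coords_def)
qed (simp add: coords_def)

text \<open>Cancelling a generator against its inverse does not lengthen a walk, as |a - b| <= max a
  b for a, b >= 0.\<close>

lemma lnorm_net_uses_le:
  assumes "1 \<le> q" "0 < k"
  shows "lnorm q k (\<lambda>i. real_of_int (net_uses p i)) \<le> Lq_length q k p"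
  using assms(1)
proof (cases rule: exponent_cases)
  case (finite r)
  define S where "S = (\<Sum>i<k. real (uses p i True) powr r + real (uses p i False) powr r)"
  have S: "0 \<le> S" unfolding S_def by (intro sum_nonneg add_nonneg_nonneg) auto
  have "\<bar>real_of_int (net_uses p i)\<bar> powr r \<le> real (uses p i True) powr r + real (uses p i False) powr r" for i
  proof -
    have "\<bar>real_of_int (net_uses p i)\<bar> powr r \<le> (max (real (uses p i True)) (real (uses p i False))) powr r"
      using finite by (intro powr_mono2) (auto simp: net_uses_def)
    also have "\<dots> \<le> real (uses p i True) powr r + real (uses p i False) powr r"
      by (auto simp: max_def)
    finally show ?thesis .
  qed
  then have "(\<Sum>i<k. \<bar>real_of_int (net_uses p i)\<bar> powr r) \<le> S"
    unfolding S_def by (intro sum_mono)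
  moreover have "(S powr (1 / r)) powr r = S" using finite S by (simp add: powr_powr)
  ultimately have "lnorm (ereal r) k (\<lambda>i. real_of_int (net_uses p i)) \<le> S powr (1 / r)"
    using finite by (subst lnorm_ereal_le_iff) auto
  then show ?thesis using finite by (simp add: Lq_length_def S_def)
next
  case infinite
  have "\<bar>real_of_int (net_uses p i)\<bar> \<le> Lq_length q k p" if "i < k" for i
  proof -
    have "uses p i True + uses p i False \<le> Max ((\<lambda>i. uses p i True + uses p i False) ` {..<k})"
      using that by (intro Max_ge) auto
    then show ?thesis by (simp add: infinite Lq_length_def net_uses_def)
  qed
  then show ?thesis using assms(2) infinite by (simp add: lnorm_infty_le_iff)
qed

text \<open>Every generator is used in one direction only, so nothing cancels and the bound of
  \<open>lnorm_net_uses_le\<close> is attained.\<close>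

lemma Lq_length_no_cancellation:
  assumes "\<And>i. i < k \<Longrightarrow> uses p i True = nat (w i)" "\<And>i. i < k \<Longrightarrow> uses p i False = nat (- w i)" "q \<noteq> -\<infinity>" "0 < k"
  shows "Lq_length q k p = lnorm q k (\<lambda>i. real_of_int (w i))"
proof (cases "q = \<infinity>")
  case True
  have *: "uses p i True + uses p i False = nat \<bar>w i\<bar>" if "i < k" for i
    using that assms by simp
  have "lnorm q k (\<lambda>i. real_of_int (w i)) = Max ((\<lambda>i. real (nat \<bar>w i\<bar>)) ` {..<k})"
    using True by (simp add: lnorm_def)
  also have "(\<lambda>i. real (nat \<bar>w i\<bar>)) ` {..<k} = real ` ((\<lambda>i. uses p i True + uses p i False) ` {..<k})"
    unfolding image_image by (intro image_cong refl) (simp only: lessThan_iff *)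
  also have "Max \<dots> = real (Max ((\<lambda>i. uses p i True + uses p i False) ` {..<k}))"
    using assms(4) by (intro mono_Max_commute [symmetric]) (auto simp: mono_def)
  finally show ?thesis using True by (simp add: Lq_length_def)
next
  case False
  have "real (uses p i True) powr r + real (uses p i False) powr r = \<bar>real_of_int (w i)\<bar> powr r" if "i < k" for i r
    using assms(1,2)[OF that] by (cases "0 \<le> w i") auto
  then show ?thesis using False by (simp add: Lq_length_def lnorm_def)
qed

lemma (in comm_group) cayley_awalk_exists:
  assumes z: "\<And>i. i < k \<Longrightarrow> z i \<in> carrier G"
    and "u \<in> carrier G" "\<And>i. i < k \<Longrightarrow> w i \<in> coords dir"
  shows "\<exists>p. pre_digraph.awalk (cayley_graph dir G k z) u p (u \<otimes> power_product G {..<k} z w) \<and>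
    (\<forall>i<k. uses p i True = nat (w i) \<and> uses p i False = nat (- w i))"
  using assms(2,3)
proof (induction "\<Sum>i<k. nat \<bar>w i\<bar>" arbitrary: u w)
  case 0
  then have w: "w i = 0" if "i < k" for i using that by simp
  then have "power_product G {..<k} z w = \<one>" by (intro power_product_zero) auto
  then have "pre_digraph.awalk (cayley_graph dir G k z) u [] (u \<otimes> power_product G {..<k} z w)"
    using 0 by (simp add: pre_digraph.awalk_def pre_digraph.cas.simps cayley_graph_def)
  then show ?case using w by (intro exI[of _ "[]"]) auto
next
  case (Suc n)
  have "\<exists>h<k. w h \<noteq> 0"
  proof (rule ccontr)
    assume "\<not> (\<exists>h<k. w h \<noteq> 0)"
    then have "(\<Sum>i<k. nat \<bar>w i\<bar>) = 0" by simp
    then show False using Suc.hyps(2) by linarith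
  qed
  then obtain h where h: "h < k" "w h \<noteq> 0" by blast
  \<comment> \<open>An arc along the sign of \<open>w h\<close> lowers the sum of the absolute
    values by one. In the directed case \<open>w h\<close> is positive, so this arc exists.\<close>
  define s where "s \<longleftrightarrow> 0 < w h"
  define j where "j = (if s then 1 else -1 :: int)"
  define w' where "w' = w(h := w h - j)"
  define u' where "u' = (if s then u \<otimes> z h else u \<otimes> inv z h)"
  have u': "u' \<in> carrier G" using Suc.prems(1) z[OF h(1)] by (simp add: u'_def)
  have "nat \<bar>w h\<bar> = Suc (nat \<bar>w' h\<bar>)" using h by (auto simp: w'_def j_def s_def)
  moreover have "(\<Sum>i\<in>{..<k} - {h}. nat \<bar>w i\<bar>) = (\<Sum>i\<in>{..<k} - {h}. nat \<bar>w' i\<bar>)"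
    by (intro sum.cong) (auto simp: w'_def)
  ultimately have "(\<Sum>i<k. nat \<bar>w i\<bar>) = Suc (\<Sum>i<k. nat \<bar>w' i\<bar>)"
    using h(1) by (simp add: sum.remove[of "{..<k}" h])
  then have n: "n = (\<Sum>i<k. nat \<bar>w' i\<bar>)" using Suc.hyps(2) by simp
  have "w' i \<in> coords dir" if "i < k" for i
    using Suc.prems(2)[OF that] by (auto simp: w'_def j_def s_def coords_def split: orientation.splits)
  from Suc.hyps(1)[OF n u' this] obtain p
    where p: "pre_digraph.awalk (cayley_graph dir G k z) u' p (u' \<otimes> power_product G {..<k} z w')"
      "\<And>i. i < k \<Longrightarrow> uses p i True = nat (w' i)" "\<And>i. i < k \<Longrightarrow> uses p i False = nat (- w' i)"
    by blast
  have "u' = u \<otimes> z h [^] j"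
    using Suc.prems(1) z[OF h(1)] int_pow_neg[of "z h" 1] by (simp add: u'_def j_def)
  also have "z h [^] j = power_product G {..<k} z (\<lambda>i. if i = h then j else 0)"
    using h z by (intro power_product_single [symmetric]) auto
  finally have "u' \<otimes> power_product G {..<k} z w' =
      u \<otimes> (power_product G {..<k} z (\<lambda>i. if i = h then j else 0) \<otimes> power_product G {..<k} z w')"
    using Suc.prems(1) z by (simp only:) (intro m_assoc power_product_closed, auto)
  also have "power_product G {..<k} z (\<lambda>i. if i = h then j else 0) \<otimes> power_product G {..<k} z w'
      = power_product G {..<k} z (\<lambda>i. (if i = h then j else 0) + w' i)"
    using z by (intro power_product_add [symmetric]) auto
  also have "(\<lambda>i. (if i = h then j else 0) + w' i) = w" by (auto simp: w'_def)
  finally have walk: "pre_digraph.awalk (cayley_graph dir G k z) u' p (u \<otimes> power_product G {..<k} z w)"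
    using p(1) by simp
  have arc: "(u, h, s) \<in> arcs (cayley_graph dir G k z)"
    using Suc.prems(1) h Suc.prems(2)[OF h(1)]
    by (auto simp: cayley_graph_def s_def coords_def split: orientation.splits)
  have "pre_digraph.awalk (cayley_graph dir G k z) u ((u, h, s) # p) (u \<otimes> power_product G {..<k} z w)"
    using walk arc Suc.prems(1)
    by (simp add: pre_digraph.awalk_def pre_digraph.cas.simps) (simp add: cayley_graph_def u'_def)
  moreover have "uses ((u, h, s) # p) i True = nat (w i) \<and> uses ((u, h, s) # p) i False = nat (- w i)" if "i < k" for i
    using p(2,3)[OF that] h(2) by (auto simp: uses_Cons w'_def j_def s_def)
  ultimately show ?case by blast
qed

lemma (in comm_group) image_lattice_ball_subset_Lq_ball:
  assumes "1 \<le> q" "0 < k" and z: "\<And>i. i < k \<Longrightarrow> z i \<in> carrier G"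
  shows "power_product G {..<k} z ` lattice_ball dir q k R \<subseteq> Lq_ball q dir G k z R"
proof
  fix x assume "x \<in> power_product G {..<k} z ` lattice_ball dir q k R"
  then obtain w where w: "w \<in> lattice_ball dir q k R" and x: "x = power_product G {..<k} z w" by blast
  have xG: "x \<in> carrier G" unfolding x using z by (intro power_product_closed) auto
  have "w i \<in> coords dir" if "i < k" for i using w that by (auto simp: lattice_ball_def)
  from cayley_awalk_exists[OF z one_closed this] xG x obtain p
    where p: "pre_digraph.awalk (cayley_graph dir G k z) \<one> p x"
      "\<And>i. i < k \<Longrightarrow> uses p i True = nat (w i)" "\<And>i. i < k \<Longrightarrow> uses p i False = nat (- w i)"
    by fastforce
  have "Lq_distance q dir G k z x \<le> ereal (Lq_length q k p)"
    unfolding Lq_distance_def using p(1) by (intro Inf_lower) blast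
  also have "Lq_length q k p = lnorm q k (\<lambda>i. real_of_int (w i))"
    using p assms(1,2) by (intro Lq_length_no_cancellation) auto
  also have "ereal \<dots> \<le> ereal R" using w by (simp add: lattice_ball_def)
  finally show "x \<in> Lq_ball q dir G k z R" using xG by (simp add: Lq_ball_def)
qed

text \<open>The distance is an infimum, and the larger radius R' yields a walk without any appeal to
  its being attained. \<open>typical_distance_ge\<close> can afford this because it refutes every
  radius strictly below R.\<close>

lemma (in comm_group) Lq_ball_subset_image_lattice_ball:
  assumes "1 \<le> q" "0 < k" and z: "\<And>i. i < k \<Longrightarrow> z i \<in> carrier G" and "R < R'"
  shows "Lq_ball q dir G k z R \<subseteq> power_product G {..<k} z ` lattice_ball dir q k R'"
proof
  fix x assume "x \<in> Lq_ball q dir G k z R"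
  then have "x \<in> carrier G" and "Lq_distance q dir G k z x < ereal R'"
    using assms(4) by (auto simp: Lq_ball_def intro: le_less_trans)
  then obtain p where p: "pre_digraph.awalk (cayley_graph dir G k z) \<one> p x" "Lq_length q k p < R'"
    by (auto simp: Lq_distance_def Inf_less_iff)
  define w where "w = restrict (net_uses p) {..<k}"
  have xp: "x = \<one> \<otimes> power_product G {..<k} z (net_uses p)"
    using cayley_awalk_end[OF p(1) z] .
  have "power_product G {..<k} z (net_uses p) \<in> carrier G"
    using z by (intro power_product_closed) auto
  then have "x = power_product G {..<k} z (net_uses p)" using xp by simp
  also have "\<dots> = power_product G {..<k} z w"
    using z by (intro power_product_cong) (auto simp: w_def)
  finally have "x = power_product G {..<k} z w" .
  moreover have "w \<in> lattice_ball dir q k R'"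
  proof -
    have "lnorm q k (\<lambda>i. real_of_int (net_uses p i)) \<le> R'"
      using lnorm_net_uses_le[OF assms(1,2), of p] p(2) by linarith
    then show ?thesis
      unfolding lattice_ball_def w_def using net_uses_coords[OF p(1)]
      by (simp only: lnorm_restrict mem_Collect_eq) auto
  qed
  ultimately show "x \<in> power_product G {..<k} z ` lattice_ball dir q k R'" by blast
qed

lemma (in comm_group) typical_distance_le:
  assumes "1 \<le> q" "0 < k" and z: "\<And>i. i < k \<Longrightarrow> z i \<in> carrier G" and "finite (carrier G)" "0 \<le> R"
    and "\<beta> * real (Coset.order G) \<le> real (card (power_product G {..<k} z ` lattice_ball dir q k R))"
  shows "typical_distance q dir G k z \<beta> \<le> ereal R"
proof -
  have "card (power_product G {..<k} z ` lattice_ball dir q k R) \<le> card (Lq_ball q dir G k z R)"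
    using assms(4) by (intro card_mono image_lattice_ball_subset_Lq_ball assms z) (auto simp: Lq_ball_def)
  then show ?thesis
    unfolding typical_distance_def using assms by (intro Inf_lower) (auto intro: order_trans)
qed

lemma (in comm_group) typical_distance_ge:
  assumes "1 \<le> q" "0 < k" and z: "\<And>i. i < k \<Longrightarrow> z i \<in> carrier G"
    and "real (card (lattice_ball dir q k R)) < \<beta> * real (Coset.order G)"
  shows "ereal R \<le> typical_distance q dir G k z \<beta>"
  unfolding typical_distance_def
proof (rule Inf_greatest, clarify)
  fix S assume S: "\<beta> * real (Coset.order G) \<le> real (card (Lq_ball q dir G k z S))"
  show "ereal R \<le> ereal S"
  proof (rule ccontr)
    assume "\<not> ereal R \<le> ereal S"
    then have "S < R" by simp
    then have "card (Lq_ball q dir G k z S) \<le> card (power_product G {..<k} z ` lattice_ball dir q k R)"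
      using finite_lattice_ball[OF assms(1)]
      by (intro card_mono Lq_ball_subset_image_lattice_ball assms z) auto
    also have "\<dots> \<le> card (lattice_ball dir q k R)"
      using finite_lattice_ball[OF assms(1)] by (rule card_image_le)
    finally show False using S assms(4) by linarith
  qed
qed

section \<open>Most elements are reached\<close>

text \<open>The \<open>k\<close>-th root of the volume of the ball of radius \<open>k powr (1 / q)\<close>.\<close>
definition ball_density :: "orientation \<Rightarrow> ereal \<Rightarrow> nat \<Rightarrow> real" where
  "ball_density dir q k =
     real (card (signs dir)) * (orthant_volume q k powr (1 / real k) * real k powr recip q)"

lemma card_signs_pos: "0 < card (signs dir)"
  by (simp add: signs_def split: orientation.splits)

lemma ball_density_pos:
  assumes "1 \<le> q" "0 < k"
  shows "0 < ball_density dir q k"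
  using assms orthant_volume_pos[OF assms(1), of k] card_signs_pos[of dir]
  by (simp add: ball_density_def)

lemma ball_density_tendsto:
  assumes "1 \<le> q"
  shows "ball_density dir q \<longlonglongrightarrow> C_const dir q"
proof -
  have "ball_density dir q \<longlonglongrightarrow> real (card (signs dir)) * C_const Directed q"
    unfolding ball_density_def by (intro tendsto_mult tendsto_const orthant_volume_asymp assms)
  also have "real (card (signs dir)) * C_const Directed q = C_const dir q"
    by (simp add: signs_def C_const_def UNIV_bool split: orientation.splits)
  finally show ?thesis .
qed

lemma C_const_pos:
  assumes "1 \<le> q"
  shows "0 < C_const dir q"
proof -
  have "0 < C_undirected q"
    using assms
  proof (cases rule: exponent_cases)
    case (finite p)
    then show ?thesis
      by (auto simp: C_undirected_def intro!: mult_pos_pos Gamma_real_pos add_pos_pos)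
  qed (simp add: C_undirected_def)
  then show ?thesis by (simp add: C_const_def split: orientation.splits)
qed

text \<open>The volume of the ball of radius x in units of k powr recip q, the units used from here
  on.\<close>

lemma ball_density_power:
  assumes "1 \<le> q" "0 < k"
  shows "(ball_density dir q k * x) ^ k =
    real (card (signs dir)) ^ k * (orthant_volume q k * (x * real k powr recip q) ^ k)"
proof -
  have "(orthant_volume q k powr (1 / real k)) ^ k = orthant_volume q k"
    using orthant_volume_pos[OF assms(1), of k] assms(2) by (simp add: powr_realpow [symmetric] powr_powr)
  then show ?thesis by (simp add: ball_density_def power_mult_distrib mult_ac)
qed

text \<open>The summand 1 is the shift by the all-ones vector. The sign factor is part of the
  density, so it cancels when compared with the whole ball in
  \<open>card_lattice_ball_ge_density\<close>.\<close>

lemma card_lattice_ball_class_le_density: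
  assumes q: "1 \<le> q" and k: "0 < k" and g: "0 < g" and s: "0 \<le> s"
  shows "real (card {w \<in> lattice_ball dir q k (s * real k powr recip q). \<forall>i<k. w i mod int g = a i mod int g})
    \<le> (ball_density dir q k * (s / real g + 1)) ^ k"
proof -
  let ?\<kappa> = "real k powr recip q"
  let ?R = "s * ?\<kappa> / real g"
  have \<kappa>: "0 < ?\<kappa>" using k by simp
  have "real (card (orthant_ball 0 q k ?R)) \<le> real (card (orthant_ball 1 q k (?R + ?\<kappa>)))"
    using card_orthant_ball_shift[OF q k, of ?R] by simp
  also have "\<dots> \<le> orthant_volume q k * (?R + ?\<kappa>) ^ k"
    using \<kappa> s by (intro card_orthant_ball_bounds q k add_nonneg_pos) auto
  also have "?R + ?\<kappa> = (s / real g + 1) * ?\<kappa>" by (simp add: algebra_simps)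
  finally have "real (card (signs dir)) ^ k * real (card (orthant_ball 0 q k ?R))
      \<le> (ball_density dir q k * (s / real g + 1)) ^ k"
    unfolding ball_density_power[OF q k] by (intro mult_left_mono) auto
  moreover have "real (card {w \<in> lattice_ball dir q k (s * ?\<kappa>). \<forall>i<k. w i mod int g = a i mod int g})
      \<le> real (card (signs dir)) ^ k * real (card (orthant_ball 0 q k ?R))"
    using card_lattice_ball_class_le[OF q k g, of dir "s * ?\<kappa>" a]
    unfolding of_nat_power [symmetric] of_nat_mult [symmetric] of_nat_le_iff .
  ultimately show ?thesis by linarith
qed

lemma card_lattice_ball_le_density:
  assumes "1 \<le> q" "0 < k" "0 \<le> s"
  shows "real (card (lattice_ball dir q k (s * real k powr recip q))) \<le> (ball_density dir q k * (s + 1)) ^ k"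
  using card_lattice_ball_class_le_density[of q k 1 s dir] assms by simp

text \<open>Nonnegative points of radius s - 1 are shifted to positive ones of radius s, which can
  then be given signs.\<close>

lemma card_lattice_ball_ge_density:
  assumes q: "1 \<le> q" and k: "0 < k" and s: "1 < s"
  shows "(ball_density dir q k * (s - 1)) ^ k \<le> real (card (lattice_ball dir q k (s * real k powr recip q)))"
proof -
  let ?\<kappa> = "real k powr recip q"
  have \<kappa>: "0 < ?\<kappa>" using k by simp
  have "orthant_volume q k * ((s - 1) * ?\<kappa>) ^ k \<le> real (card (orthant_ball 0 q k ((s - 1) * ?\<kappa>)))"
    using \<kappa> s by (intro card_orthant_ball_bounds q k) auto
  also have "\<dots> \<le> real (card (orthant_ball 1 q k (s * ?\<kappa>)))"
    using card_orthant_ball_shift[OF q k, of "(s - 1) * ?\<kappa>"] by (simp add: algebra_simps)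
  finally have "(ball_density dir q k * (s - 1)) ^ k
      \<le> real (card (signs dir)) ^ k * real (card (orthant_ball 1 q k (s * ?\<kappa>)))"
    unfolding ball_density_power[OF q k] by (intro mult_left_mono) auto
  also have "\<dots> \<le> real (card (lattice_ball dir q k (s * ?\<kappa>)))"
    using card_lattice_ball_ge[OF q k, of dir "s * ?\<kappa>"]
    unfolding of_nat_power [symmetric] of_nat_mult [symmetric] of_nat_le_iff .
  finally show ?thesis .
qed

lemma lattice_ball_mono: "R \<le> S \<Longrightarrow> lattice_ball dir q k R \<subseteq> lattice_ball dir q k S"
  unfolding lattice_ball_def by (blast intro: order_trans)

section \<open>The sum over the moduli\<close>

lemma sum_inverse_squares_le: "(\<Sum>g=2..m. 1 / real g ^ 2) \<le> 1"
proof (cases "1 \<le> m")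
  case True
  have "(\<Sum>g=2..m. 1 / real g ^ 2) \<le> 1 - 1 / real m"
    using True
  proof (induction m rule: nat_induct_at_least)
    case (Suc m)
    have "1 / real (Suc m) ^ 2 \<le> 1 / real m - 1 / real (Suc m)"
    proof -
      have "1 / real m - 1 / real (Suc m) = 1 / (real m * real (Suc m))"
        using Suc.hyps by (simp add: diff_frac_eq)
      also have "1 / real (Suc m) ^ 2 \<le> \<dots>"
        using Suc.hyps unfolding power2_eq_square by (intro divide_left_mono mult_right_mono) auto
      finally show ?thesis .
    qed
    moreover have "(\<Sum>g=2..Suc m. 1 / real g ^ 2) = (\<Sum>g=2..m. 1 / real g ^ 2) + 1 / real (Suc m) ^ 2"
      using Suc.hyps by (simp add: sum.cl_ivl_Suc)
    ultimately show ?case using Suc.IH by linarith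
  qed auto
  then show ?thesis by (smt (verit) divide_nonneg_nonneg of_nat_0_le_iff)
qed auto

text \<open>The index is at most \<open>n * min 1 y\<close> with \<open>y = g powr ((1 - \<delta>) * k) / n\<close>, and \<open>min 1 y \<le> y powr \<theta>\<close>.
  The exponent \<open>\<theta> = 2 / (\<delta> * k)\<close> makes the sum over the \<open>O(k * n powr (1 / k))\<close> relevant
  moduli \<open>g\<close> polynomial in \<open>k\<close>, uniformly in \<open>n\<close>.\<close>
lemma (in comm_group) power_index_le_interpolated:
  assumes fin: "finite (carrier G)" and g: "0 < g"
    and d: "real (min_generators G) \<le> (1 - \<delta>) * real k"
    and \<delta>: "0 < \<delta>" "2 / \<delta> \<le> real k"
  shows "power_index g \<le> real (Coset.order G) *
    (real g powr (2 / \<delta> - 2) / (real (Coset.order G) powr (1 / real k)) powr (2 / \<delta>))"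
proof -
  define n where "n = real (Coset.order G)"
  define y where "y = real g powr ((1 - \<delta>) * real k) / n"
  define \<theta> where "\<theta> = 2 / (\<delta> * real k)"
  have k: "0 < real k" using \<delta> by (smt (verit) divide_pos_pos)
  have n: "0 < n" using fin by (auto simp: n_def Coset.order_def card_gt_0_iff)
  have y: "0 < y" using n g by (simp add: y_def)
  have \<theta>: "0 < \<theta>" "\<theta> \<le> 1" using \<delta> k by (auto simp: \<theta>_def field_simps)
  have "power_index g \<le> real g ^ min_generators G" by (rule power_index_le_power[OF fin g])
  also have "\<dots> = real g powr real (min_generators G)" using g by (simp add: powr_realpow)
  also have "\<dots> \<le> real g powr ((1 - \<delta>) * real k)" using d g by (intro powr_mono) auto
  finally have "power_index g \<le> n * y" using n by (simp add: y_def)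
  moreover have "power_index g \<le> n" unfolding n_def by (rule power_index_le_order[OF fin])
  ultimately have "power_index g \<le> n * min 1 y" by (simp add: min_def)
  also have "min 1 y \<le> y powr \<theta>"
  proof (cases "1 \<le> y")
    case True
    then show ?thesis using \<theta> by (simp add: ge_one_powr_ge_zero)
  next
    case False
    then have "y powr 1 \<le> y powr \<theta>" using y \<theta> by (intro powr_mono') auto
    then show ?thesis using False y by simp
  qed
  also have "y powr \<theta> = real g powr (2 / \<delta> - 2) / (n powr (1 / real k)) powr (2 / \<delta>)"
  proof -
    have "(1 - \<delta>) * real k * \<theta> = 2 / \<delta> - 2" "\<theta> = 1 / real k * (2 / \<delta>)"
      using k \<delta> by (simp_all add: \<theta>_def field_simps)
    then show ?thesis by (simp add: y_def powr_divide powr_powr)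
  qed
  finally show ?thesis using n by (simp add: n_def)
qed

text \<open>By \<open>volume\<close> the ball has at least A ^ (2 * k) * n points. The three terms
  of the bound come from the pairs v = w, the moduli 2 <= g <= \<rho> * s, and the larger moduli. In
  the middle range, the index times the share of a class in the ball is at most (g powr (- \<delta>
  / 2)) ^ k by \<open>intermediate\<close>. In the last range a class has at most A ^ k points; this
  uses up half of the excess A ^ (2 * k), and the other half beats any power of k.\<close>

lemma (in comm_group) card_small_image_lattice_ball_le:
  fixes \<delta> \<beta> A M \<rho> :: real
  assumes fin: "finite (carrier G)" and q: "1 \<le> q" and k: "0 < k"
    and d: "real (min_generators G) \<le> (1 - \<delta>) * real k"
    and \<delta>: "0 < \<delta>" "\<delta> < 1" "4 / \<delta> \<le> real k"
    and \<beta>: "0 < \<beta>" "\<beta> < 1" and A: "0 < A" and M: "0 < M" and \<rho>: "0 < \<rho>"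
  defines "n \<equiv> real (Coset.order G)"
  defines "L \<equiv> n powr (1 / real k)"
  defines "s \<equiv> M * L / 2"
  assumes s: "1 < s"
    and volume: "A ^ 2 * L \<le> ball_density dir q k * (s - 1)"
    and intermediate: "\<And>g. 2 \<le> g \<Longrightarrow> real g \<le> \<rho> * s \<Longrightarrow>
      real g powr (- \<delta>) * ((1 + real g / s) / (1 - 1 / s)) \<le> real g powr (- \<delta> / 2)"
    and small: "real (card (lattice_ball Undirected q k (2 / \<rho> * real k powr recip q))) \<le> A ^ k"
  shows "real (card {z \<in> {..<k} \<rightarrow>\<^sub>E carrier G.
            real (card (power_product G {..<k} z ` lattice_ball dir q k (s * real k powr recip q))) < \<beta> * n})
          * (1 / \<beta> - 1)
     \<le> n ^ k * (1 / A ^ (2 * k) + 2 powr (2 - \<delta> * real k / 2)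
          + (M * real k) powr (2 / \<delta> - 1) / (A ^ k * L))"
proof -
  define \<kappa> where "\<kappa> = real k powr recip q"
  define B where "B = lattice_ball dir q k (s * \<kappa>)"
  define b where "b = real (card B)"
  define a where "a = ball_density dir q k"
  \<comment> \<open>Coordinates of a difference of two points of B are at most 2 * s * \<kappa>, so
    larger moduli do not occur.\<close>
  define m where "m = nat \<lfloor>2 * s * \<kappa>\<rfloor>"
  define K where "K g = (if real g \<le> \<rho> * s then (a * (s / real g + 1)) ^ k else A ^ k)" for g :: nat
  \<comment> \<open>T bounds the share of a single modulus above \<rho> * s. As \<kappa> <= k, there
    are at most M * L * k of them, which raises the exponent 2 / \<delta> - 2 by one and leaves 1 /
    L of 1 / L ^ 2.\<close>
  define T where "T = (M * real k) powr (2 / \<delta> - 2) / (A ^ k * L ^ 2)"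
  have n: "0 < n" using fin by (auto simp: n_def Coset.order_def card_gt_0_iff)
  have L: "0 < L" "L ^ k = n" using n k by (auto simp: L_def powr_realpow [symmetric] powr_powr)
  have a: "0 < a" unfolding a_def by (rule ball_density_pos[OF q k])
  have "0 \<le> recip q" "recip q \<le> 1"
    using q by (cases rule: exponent_cases; simp)+
  then have \<kappa>: "0 < \<kappa>" "\<kappa> \<le> real k"
    using k powr_mono[of "recip q" 1 "real k"] by (auto simp: \<kappa>_def)
  have b1: "(a * (s - 1)) ^ k \<le> b"
    unfolding a_def b_def B_def \<kappa>_def by (rule card_lattice_ball_ge_density[OF q k s])
  moreover have "0 < (a * (s - 1)) ^ k" using a s by (intro zero_less_power mult_pos_pos) auto
  ultimately have b: "0 < b" by linarith
  have "(A ^ 2 * L) ^ k \<le> (a * (s - 1)) ^ k"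
    using volume A L by (intro power_mono) (auto simp: a_def)
  then have b2: "A ^ (2 * k) * n \<le> b"
    using b1 L by (simp add: power_mult_distrib power_mult)
  have finB: "finite B" unfolding B_def by (rule finite_lattice_ball[OF q])
  have m: "real m \<le> M * L * real k"
  proof -
    have "real m \<le> 2 * s * \<kappa>" using s \<kappa> by (simp add: m_def)
    also have "\<dots> \<le> 2 * s * real k" using s \<kappa> by (intro mult_left_mono) auto
    finally show ?thesis by (simp add: s_def)
  qed
  have "real (card {z \<in> {..<k} \<rightarrow>\<^sub>E carrier G.
              real (card (power_product G {..<k} z ` B)) < \<beta> * real (Coset.order G)}) * (1 / \<beta> - 1)
     \<le> real (Coset.order G) ^ k * (real (Coset.order G) / real (card B) +
          (\<Sum>g=2..m. power_index g * K g) / real (card B))"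
  proof (rule card_small_image_le[OF fin finB _ _ _ _ \<beta>])
    show "B \<subseteq> {..<k} \<rightarrow>\<^sub>E UNIV" by (auto simp: B_def lattice_ball_def)
    show "B \<noteq> {}" using b by (auto simp: b_def)
    show "\<bar>v i - w i\<bar> \<le> int m" if "v \<in> B" "w \<in> B" "i < k" for v w i
    proof -
      have "\<bar>real_of_int (v i)\<bar> \<le> s * \<kappa>" "\<bar>real_of_int (w i)\<bar> \<le> s * \<kappa>"
        using that by (auto simp: B_def lattice_ball_def intro!: coordinate_le_lnorm[OF q])
      then have "real_of_int \<bar>v i - w i\<bar> \<le> 2 * s * \<kappa>" by simp
      then have "\<bar>v i - w i\<bar> \<le> \<lfloor>2 * s * \<kappa>\<rfloor>" by (simp only: le_floor_iff)
      then show ?thesis unfolding m_def by linarith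
    qed
    show "real (card {w \<in> B. \<forall>i<k. w i mod int g = c i mod int g}) \<le> K g" if "2 \<le> g" "g \<le> m" for c g
    proof (cases "real g \<le> \<rho> * s")
      case True
      then show ?thesis
        using card_lattice_ball_class_le_density[OF q k, of g s dir c] that s
        by (simp add: K_def B_def \<kappa>_def a_def)
    next
      case False
      \<comment> \<open>As g exceeds \<rho> * s, contraction reduces the radius to at most 2 /
        \<rho> units, where \<open>small\<close> applies.\<close>
      have "2 * (s * \<kappa>) / real g \<le> 2 / \<rho> * \<kappa>"
        using False \<rho> \<kappa> that s by (simp add: field_simps)
      then have "card (lattice_ball Undirected q k (2 * (s * \<kappa>) / real g))
          \<le> card (lattice_ball Undirected q k (2 / \<rho> * \<kappa>))"
        by (intro card_mono lattice_ball_mono finite_lattice_ball q)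
      moreover have "card {w \<in> B. \<forall>i<k. w i mod int g = c i mod int g}
          \<le> card (lattice_ball Undirected q k (2 * (s * \<kappa>) / real g))"
        unfolding B_def using that by (intro card_lattice_ball_class_le_contracted q k) auto
      ultimately show ?thesis using False small by (simp add: K_def \<kappa>_def)
    qed
  qed
  also have "\<dots> \<le> n ^ k * (1 / A ^ (2 * k) + (2 powr (2 - \<delta> * real k / 2)
      + (M * real k) powr (2 / \<delta> - 1) / (A ^ k * L)))"
    unfolding n_def [symmetric] b_def [symmetric]
  proof (intro mult_left_mono add_mono)
    show "n / b \<le> 1 / A ^ (2 * k)" using b2 b A by (simp add: field_simps)
    \<comment> \<open>Every g is charged with the sum of the bounds for the two ranges, which avoids
      splitting the sum at \<rho> * s.\<close>
    have "power_index g * K g / b \<le> 2 powr (2 - \<delta> * real k / 2) * (1 / real g ^ 2) + T"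
      if g: "g \<in> {2..m}" for g
    proof (cases "real g \<le> \<rho> * s")
      case True
      have g2: "2 \<le> real g" "2 \<le> g" using g by auto
      have "power_index g \<le> real g ^ min_generators G"
        using g by (intro power_index_le_power fin) auto
      also have "\<dots> = real g powr real (min_generators G)" using g by (simp add: powr_realpow)
      also have "\<dots> \<le> real g powr ((1 - \<delta>) * real k)" using d g by (intro powr_mono) auto
      also have "\<dots> = (real g powr (1 - \<delta>)) ^ k" using g by (simp add: powr_realpow [symmetric] powr_powr)
      finally have pi: "power_index g \<le> (real g powr (1 - \<delta>)) ^ k" .
      have "power_index g * K g / b \<le> (real g powr (1 - \<delta>)) ^ k * (a * (s / real g + 1)) ^ k / (a * (s - 1)) ^ k"
        using True pi b1 a s by (auto simp: K_def intro!: frac_le mult_right_mono mult_nonneg_nonneg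
            zero_le_power add_nonneg_nonneg)
      also have "\<dots> = (real g powr (1 - \<delta>) * (a * (s / real g + 1)) / (a * (s - 1))) ^ k"
        by (simp add: power_mult_distrib power_divide)
      also have "real g powr (1 - \<delta>) * (a * (s / real g + 1)) / (a * (s - 1))
          = real g powr (- \<delta>) * ((1 + real g / s) / (1 - 1 / s))"
      proof -
        have "real g powr (1 - \<delta>) = real g * real g powr (- \<delta>)"
          using g2 by (simp add: powr_diff powr_minus field_simps)
        moreover have "real g * (s / real g + 1) / (s - 1) = (1 + real g / s) / (1 - 1 / s)"
          using g2 s by (simp add: field_simps)
        ultimately show ?thesis
          using a by (simp add: mult_ac) (metis (no_types, opaque_lifting) mult.left_commute times_divide_eq_right)
      qed
      also have "\<dots> ^ k \<le> (real g powr (- \<delta> / 2)) ^ k"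
        using intermediate[OF g2(2) True] s by (intro power_mono) (auto simp: field_simps)
      \<comment> \<open>The factor g powr (-2) is set aside to make the sum over g converge. The
        remaining exponent is at most 0 because \<open>4 / \<delta> \<le> k\<close>, so its base may
        be lowered to 2.\<close>
      also have "\<dots> = real g powr (2 - \<delta> * real k / 2) * real g powr (-2)"
        using g2 by (simp add: powr_realpow [symmetric] powr_powr powr_add [symmetric])
      also have "\<dots> \<le> 2 powr (2 - \<delta> * real k / 2) * real g powr (-2)"
        using g2 \<delta> by (intro mult_right_mono powr_mono2') (auto simp: field_simps)
      also have "real g powr (-2) = 1 / real g ^ 2"
        using g2 by (simp add: powr_minus_divide powr_numeral)
      finally have "power_index g * K g / b \<le> 2 powr (2 - \<delta> * real k / 2) * (1 / real g ^ 2)" .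
      moreover have "0 \<le> T" using A L M by (simp add: T_def)
      ultimately show ?thesis by linarith
    next
      case False
      have g2: "2 \<le> real g" "real g \<le> M * L * real k" using g m by auto
      have "2 / \<delta> \<le> 4 / \<delta>" using \<delta> by (intro divide_right_mono) auto
      then have "power_index g \<le> n * (real g powr (2 / \<delta> - 2) / L powr (2 / \<delta>))"
        unfolding n_def L_def using g \<delta> by (intro power_index_le_interpolated fin d) auto
      also have "\<dots> \<le> n * ((M * L * real k) powr (2 / \<delta> - 2) / L powr (2 / \<delta>))"
        using g2 n \<delta> by (intro mult_left_mono divide_right_mono powr_mono2) (auto simp: field_simps)
      also have "(M * L * real k) powr (2 / \<delta> - 2) / L powr (2 / \<delta>) = (M * real k) powr (2 / \<delta> - 2) / L ^ 2"
      proof -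
        have "L powr (2 / \<delta>) = L powr (2 / \<delta> - 2) * L ^ 2"
          using L by (simp add: powr_diff powr_numeral)
        moreover have "(M * L * real k) powr (2 / \<delta> - 2) = (M * real k) powr (2 / \<delta> - 2) * L powr (2 / \<delta> - 2)"
          by (simp add: powr_mult)
        ultimately show ?thesis using L by simp
      qed
      finally have pi: "power_index g \<le> n * ((M * real k) powr (2 / \<delta> - 2) / L ^ 2)" .
      have "power_index g * K g / b
          \<le> n * ((M * real k) powr (2 / \<delta> - 2) / L ^ 2) * A ^ k / (A ^ (2 * k) * n)"
      proof -
        have "K g = A ^ k" using False by (simp add: K_def)
        then show ?thesis
          by (simp only:) (intro frac_le mult_right_mono pi b2; use A n L M in simp)
      qed
      also have "\<dots> = T"
        using A n by (simp add: T_def power_mult power2_eq_square mult_2 power_add)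
      finally show ?thesis by (smt (verit) divide_nonneg_nonneg mult_nonneg_nonneg powr_ge_zero zero_le_power2)
    qed
    then have "(\<Sum>g=2..m. power_index g * K g / b)
        \<le> (\<Sum>g=2..m. 2 powr (2 - \<delta> * real k / 2) * (1 / real g ^ 2) + T)"
      by (intro sum_mono)
    also have "\<dots> = 2 powr (2 - \<delta> * real k / 2) * (\<Sum>g=2..m. 1 / real g ^ 2) + real (card {2..m}) * T"
      by (simp add: sum.distrib sum_distrib_left)
    also have "\<dots> \<le> 2 powr (2 - \<delta> * real k / 2) * 1 + (M * L * real k) * T"
    proof (intro add_mono mult_left_mono mult_right_mono sum_inverse_squares_le)
      show "real (card {2..m}) \<le> M * L * real k" using m by simp
      show "0 \<le> T" using A L M by (simp add: T_def)
    qed auto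
    also have "(M * L * real k) * T = (M * real k) powr (2 / \<delta> - 1) / (A ^ k * L)"
    proof -
      have "(M * real k) powr (2 / \<delta> - 1) = (M * real k) powr (1 + (2 / \<delta> - 2))"
        by simp
      also have "\<dots> = (M * real k) * (M * real k) powr (2 / \<delta> - 2)"
        unfolding powr_add using M k by simp
      finally show ?thesis using L A by (simp add: T_def power2_eq_square field_simps)
    qed
    finally show "(\<Sum>g=2..m. power_index g * K g) / b \<le> 2 powr (2 - \<delta> * real k / 2)
        + (M * real k) powr (2 / \<delta> - 1) / (A ^ k * L)"
      by (simp add: sum_divide_distrib)
  qed (use n in auto)
  finally show ?thesis
    by (simp add: B_def \<kappa>_def n_def add.assoc)
qed

section \<open>Typical distance\<close>

text \<open>The event is the disjoint union of the events \<open>E z\<close> for z in Q, each of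
  probability n ^ (-k) by independence. \<open>0 < k\<close> keeps the intersection defining
  \<open>E z\<close> inside \<open>space M\<close>.\<close>

lemma iid_uniform_tuple_prob:
  assumes M: "prob_space M" and iid: "iid_uniform M G k Z" and fin: "finite (carrier G)"
    and k: "0 < k" and Q: "Q \<subseteq> {..<k} \<rightarrow>\<^sub>E carrier G"
  shows "{\<omega> \<in> space M. restrict (\<lambda>i. Z i \<omega>) {..<k} \<in> Q} \<in> sets M"
    and "measure M {\<omega> \<in> space M. restrict (\<lambda>i. Z i \<omega>) {..<k} \<in> Q} = real (card Q) / real (Coset.order G) ^ k"
proof -
  interpret prob_space M by fact
  have indep: "indep_vars (\<lambda>_. count_space (carrier G)) Z {..<k}"
    and distr: "\<And>i. i < k \<Longrightarrow> distr M (count_space (carrier G)) (Z i) = uniform_count_measure (carrier G)"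
    using iid by (auto simp: iid_uniform_def)
  have meas: "Z i \<in> measurable M (count_space (carrier G))" if "i < k" for i
    using indep that by (simp add: indep_vars_def)
  define E where "E z = (\<Inter>i<k. Z i -` {z i} \<inter> space M)" for z :: "nat \<Rightarrow> 'b"
  have single: "Z i -` {x} \<inter> space M \<in> sets M" if "i < k" "x \<in> carrier G" for i x
    using meas[OF that(1)] that by (intro measurable_sets) auto
  have E: "E z \<in> sets M" "measure M (E z) = 1 / real (Coset.order G) ^ k" if z: "z \<in> {..<k} \<rightarrow>\<^sub>E carrier G" for z
  proof -
    have zi: "z i \<in> carrier G" if "i < k" for i using z that by auto
    show "E z \<in> sets M"
      unfolding E_def using k single zi by (intro sets.finite_INT) auto
    have "measure M (E z) = (\<Prod>i<k. measure M (Z i -` {z i} \<inter> space M))"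
      unfolding E_def using k zi by (intro indep_varsD[OF indep]) auto
    also have "\<dots> = (\<Prod>i<k. 1 / real (Coset.order G))"
    proof (rule prod.cong[OF refl])
      fix i assume "i \<in> {..<k}"
      then have i: "i < k" by simp
      have "measure M (Z i -` {z i} \<inter> space M) = measure (distr M (count_space (carrier G)) (Z i)) {z i}"
        using meas[OF i] zi[OF i] by (subst measure_distr) auto
      also have "\<dots> = 1 / real (Coset.order G)"
        unfolding distr[OF i] using fin zi[OF i] by (simp add: measure_uniform_count_measure Coset.order_def)
      finally show "measure M (Z i -` {z i} \<inter> space M) = 1 / real (Coset.order G)" .
    qed
    finally show "measure M (E z) = 1 / real (Coset.order G) ^ k" by (simp add: power_divide)
  qed
  have finQ: "finite Q" using Q fin by (meson finite_PiE finite_lessThan finite_subset)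
  have union: "{\<omega> \<in> space M. restrict (\<lambda>i. Z i \<omega>) {..<k} \<in> Q} = (\<Union>z\<in>Q. E z)"
  proof (intro equalityI subsetI)
    fix \<omega> assume "\<omega> \<in> {\<omega> \<in> space M. restrict (\<lambda>i. Z i \<omega>) {..<k} \<in> Q}"
    then show "\<omega> \<in> (\<Union>z\<in>Q. E z)"
      by (intro UN_I[of "restrict (\<lambda>i. Z i \<omega>) {..<k}"]) (auto simp: E_def)
  next
    fix \<omega> assume "\<omega> \<in> (\<Union>z\<in>Q. E z)"
    then obtain z where z: "z \<in> Q" "\<omega> \<in> E z" by blast
    then have "\<omega> \<in> space M" using k unfolding E_def by blast
    moreover have "Z i \<omega> = z i" if "i < k" for i using z(2) that unfolding E_def by blast
    then have "restrict (\<lambda>i. Z i \<omega>) {..<k} = z"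
      using z(1) Q by (intro PiE_ext[of _ "{..<k}" "\<lambda>_. UNIV"]) (auto simp: PiE_iff)
    ultimately show "\<omega> \<in> {\<omega> \<in> space M. restrict (\<lambda>i. Z i \<omega>) {..<k} \<in> Q}" using z by simp
  qed
  have disj: "disjoint_family_on E Q"
    unfolding disjoint_family_on_def
  proof (intro ballI impI)
    fix y z assume yz: "y \<in> Q" "z \<in> Q" "y \<noteq> z"
    then obtain i where "i < k" "y i \<noteq> z i"
      using Q PiE_ext[of y "{..<k}" "\<lambda>_. carrier G" z] by (meson lessThan_iff subsetD)
    then show "E y \<inter> E z = {}" by (auto simp: E_def)
  qed
  show "{\<omega> \<in> space M. restrict (\<lambda>i. Z i \<omega>) {..<k} \<in> Q} \<in> sets M"
    unfolding union using E(1) Q finQ by (intro sets.finite_UN) auto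
  have "measure M (\<Union>z\<in>Q. E z) = (\<Sum>z\<in>Q. measure M (E z))"
    using E(1) Q finQ disj by (intro finite_measure_finite_Union) auto
  also have "\<dots> = (\<Sum>z\<in>Q. 1 / real (Coset.order G) ^ k)"
    using E(2) Q by (intro sum.cong) auto
  finally show "measure M {\<omega> \<in> space M. restrict (\<lambda>i. Z i \<omega>) {..<k} \<in> Q} = real (card Q) / real (Coset.order G) ^ k"
    unfolding union by simp
qed

section \<open>Estimates as N tends to infinity\<close>

text \<open>Half of the exponent \<delta> pays for the lattice correction. For g <= \<tau> * s the
  correction is close to 1 + \<tau>, which lies below 2 powr (\<delta> / 2) by the choice of \<tau>.
  For g between \<tau> * s and \<rho> * s it stays bounded, while g powr (\<delta> / 2) tends to
  infinity with s.\<close>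

lemma eventually_intermediate_moduli:
  fixes \<delta> \<rho> :: real
  assumes "0 < \<delta>" "0 < \<rho>"
  shows "\<forall>\<^sub>F s in at_top. \<forall>g\<ge>2. g \<le> \<rho> * s \<longrightarrow>
    g powr (- \<delta>) * ((1 + g / s) / (1 - 1 / s)) \<le> g powr (- \<delta> / 2)"
proof -
  define u where "u = 2 powr (\<delta> / 2)"
  define \<tau> where "\<tau> = (u - 1) / 2"
  have u: "1 < u" using assms by (simp add: u_def)
  then have \<tau>: "0 < \<tau>" "1 + \<tau> < u" by (simp_all add: \<tau>_def field_simps)
  have "((\<lambda>s. u * (1 - 1 / s)) \<longlongrightarrow> u) at_top" by real_asymp
  then have ev1: "\<forall>\<^sub>F s in at_top. 1 + \<tau> < u * (1 - 1 / s)" using \<tau> by (simp add: order_tendstoD)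
  have "filterlim (\<lambda>s. (\<tau> * s) powr (\<delta> / 2) * (1 - 1 / s)) at_top at_top"
    using assms \<tau> by real_asymp
  then have ev2: "\<forall>\<^sub>F s in at_top. 1 + \<rho> < (\<tau> * s) powr (\<delta> / 2) * (1 - 1 / s)"
    by (simp add: filterlim_at_top_dense)
  show ?thesis
    using ev1 ev2 eventually_gt_at_top[of 1]
  proof eventually_elim
    case (elim s)
    show ?case
    proof (intro allI impI)
      fix g :: real assume g: "2 \<le> g" "g \<le> \<rho> * s"
      have pos: "0 < 1 - 1 / s" using elim by simp
      have "1 + g / s \<le> g powr (\<delta> / 2) * (1 - 1 / s)"
      proof (cases "g \<le> \<tau> * s")
        case True
        then have "1 + g / s \<le> 1 + \<tau>" using elim by (simp add: field_simps)
        also have "\<dots> \<le> u * (1 - 1 / s)" using elim by simp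
        also have "\<dots> \<le> g powr (\<delta> / 2) * (1 - 1 / s)"
          unfolding u_def using g pos assms by (intro mult_right_mono powr_mono2) auto
        finally show ?thesis .
      next
        case False
        have "1 + g / s \<le> 1 + \<rho>" using g elim by (simp add: field_simps)
        also have "\<dots> \<le> (\<tau> * s) powr (\<delta> / 2) * (1 - 1 / s)" using elim by simp
        also have "\<dots> \<le> g powr (\<delta> / 2) * (1 - 1 / s)"
          using False pos assms \<tau> elim by (intro mult_right_mono powr_mono2) auto
        finally show ?thesis .
      qed
      then have "(1 + g / s) / (1 - 1 / s) \<le> g powr (\<delta> / 2)"
        using pos by (simp add: divide_le_eq)
      then have "g powr (- \<delta>) * ((1 + g / s) / (1 - 1 / s)) \<le> g powr (- \<delta>) * g powr (\<delta> / 2)"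
        by (intro mult_left_mono) auto
      also have "\<dots> = g powr (- \<delta> / 2)" by (simp add: powr_add [symmetric])
      finally show "g powr (- \<delta>) * ((1 + g / s) / (1 - 1 / s)) \<le> g powr (- \<delta> / 2)" .
    qed
  qed
qed

text \<open>Divided by L, the k-th root of the upper bound for the count tends to 1 - \<epsilon>. It
  is eventually below 1 - \<epsilon> / 2, whose k-th power tends to 0.\<close>

lemma eventually_card_lattice_ball_small:
  fixes n :: "nat \<Rightarrow> nat" and k :: "nat \<Rightarrow> nat"
  assumes q: "1 \<le> q" and k: "filterlim k at_top sequentially"
    and L: "filterlim (\<lambda>N. real (n N) powr (1 / real (k N))) at_top sequentially"
    and \<beta>: "0 < \<beta>" and \<epsilon>: "0 < \<epsilon>" "\<epsilon> < 1"
  shows "\<forall>\<^sub>F N in sequentially.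
    real (card (lattice_ball dir q (k N) ((1 - \<epsilon>) * D_const dir q (k N) (n N)))) < \<beta> * real (n N)"
proof -
  define C where "C = C_const dir q"
  define L where "L N = real (n N) powr (1 / real (k N))" for N
  define a where "a N = ball_density dir q (k N)" for N
  define s where "s N = (1 - \<epsilon>) * L N / C" for N
  have C: "0 < C" unfolding C_def by (rule C_const_pos[OF q])
  have a: "a \<longlonglongrightarrow> C"
    unfolding a_def C_def by (rule filterlim_compose[OF ball_density_tendsto[OF q] k])
  have Ltop: "filterlim L at_top sequentially" using L by (simp add: L_def [abs_def])
  then have Linv: "(\<lambda>N. inverse (L N)) \<longlonglongrightarrow> 0"
    by (rule tendsto_inverse_0_at_top)
  have "(\<lambda>N. a N * ((1 - \<epsilon>) / C + inverse (L N))) \<longlonglongrightarrow> C * ((1 - \<epsilon>) / C + 0)"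
    by (intro tendsto_intros a Linv)
  then have "\<forall>\<^sub>F N in sequentially. a N * ((1 - \<epsilon>) / C + inverse (L N)) < 1 - \<epsilon> / 2"
    using C \<epsilon> by (intro order_tendstoD(2)) auto
  moreover have "(\<lambda>N. (1 - \<epsilon> / 2) ^ k N) \<longlonglongrightarrow> 0"
    using \<epsilon> by (intro filterlim_compose[OF LIMSEQ_power_zero k]) auto
  then have "\<forall>\<^sub>F N in sequentially. (1 - \<epsilon> / 2) ^ k N < \<beta>"
    using \<beta> by (rule order_tendstoD)
  moreover have "\<forall>\<^sub>F N in sequentially. 0 < L N" using Ltop by (simp add: filterlim_at_top_dense)
  moreover have "\<forall>\<^sub>F N in sequentially. 0 < k N"
    using k [unfolded filterlim_at_top, rule_format, of 1] by (simp add: Suc_le_eq)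
  ultimately show ?thesis
  proof eventually_elim
    case (elim N)
    have R: "(1 - \<epsilon>) * D_const dir q (k N) (n N) = s N * real (k N) powr recip q"
      by (simp add: D_const_def s_def C_def L_def)
    have s: "0 \<le> s N" using \<epsilon> C by (simp add: s_def L_def)
    have a0: "0 < a N" unfolding a_def by (rule ball_density_pos[OF q elim(4)])
    have n: "L N ^ k N = real (n N)"
      using elim(3,4) by (simp add: L_def powr_realpow [symmetric] powr_powr)
    have "real (card (lattice_ball dir q (k N) (s N * real (k N) powr recip q))) \<le> (a N * (s N + 1)) ^ k N"
      unfolding a_def by (rule card_lattice_ball_le_density[OF q elim(4) s])
    also have "a N * (s N + 1) = (a N * ((1 - \<epsilon>) / C + inverse (L N))) * L N"
      using elim(3) C by (simp add: s_def field_simps)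
    also have "\<dots> ^ k N \<le> ((1 - \<epsilon> / 2) * L N) ^ k N"
      using elim a0 C \<epsilon> by (intro power_mono mult_right_mono mult_nonneg_nonneg) auto
    also have "\<dots> = (1 - \<epsilon> / 2) ^ k N * real (n N)" by (simp add: power_mult_distrib n)
    also have "\<dots> < \<beta> * real (n N)"
    proof (rule mult_strict_right_mono[OF elim(2)])
      have "0 < L N ^ k N" using elim(3) by simp
      then show "0 < real (n N)" using n by simp
    qed
    finally show ?case unfolding R .
  qed
qed

lemma card_small_image_asymp:
  fixes G :: "nat \<Rightarrow> 'a monoid" and k :: "nat \<Rightarrow> nat"
  assumes q: "1 \<le> q"
    and G: "\<And>N. comm_group (G N)" "\<And>N. finite (carrier (G N))"
    and k: "filterlim k at_top sequentially"
    and L: "filterlim (\<lambda>N. real (Coset.order (G N)) powr (1 / real (k N))) at_top sequentially"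
    and \<delta>: "0 < \<delta>" "\<delta> < 1"
    and d: "\<forall>\<^sub>F N in sequentially. real (min_generators (G N)) \<le> (1 - \<delta>) * real (k N)"
    and \<beta>: "0 < \<beta>" "\<beta> < 1" and \<epsilon>: "0 < \<epsilon>"
  shows "(\<lambda>N. real (card {z \<in> {..<k N} \<rightarrow>\<^sub>E carrier (G N).
      real (card (power_product (G N) {..<k N} z `
        lattice_ball dir q (k N) ((1 + \<epsilon>) * D_const dir q (k N) (Coset.order (G N)))))
      < \<beta> * real (Coset.order (G N))}) / real (Coset.order (G N)) ^ k N) \<longlonglongrightarrow> 0"
    (is "(\<lambda>N. real (card (?bad N)) / _) \<longlonglongrightarrow> 0")
proof -
  define C where "C = C_const dir q"
  \<comment> \<open>With this M, the radius s in units of k powr recip q is that of the ball of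
    radius (1 + \<epsilon>) * D. The quotient a * (s - 1) / L tends to 1 + \<epsilon>, and A ^ 2 = 1
    + \<epsilon> / 2 stays below this limit.\<close>
  define M where "M = 2 * (1 + \<epsilon>) / C"
  define A where "A = sqrt (1 + \<epsilon> / 2)"
  define L where "L N = real (Coset.order (G N)) powr (1 / real (k N))" for N
  define s where "s N = M * L N / 2" for N
  define a where "a N = ball_density dir q (k N)" for N
  have C: "0 < C" unfolding C_def by (rule C_const_pos[OF q])
  have M: "0 < M" using C \<epsilon> by (simp add: M_def)
  have A: "1 < A" "A ^ 2 = 1 + \<epsilon> / 2" using \<epsilon> by (auto simp: A_def)
  \<comment> \<open>Taking \<eta> = ln A bounds the small ball by A ^ k; its radius s0 then
    determines \<rho>.\<close>
  have "0 < ln A" using A by simp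
  then obtain s0 where s0: "0 < s0"
    and small: "\<And>k. 0 < k \<Longrightarrow> real (card (lattice_ball Undirected q k (s0 * real k powr recip q))) \<le> exp (ln A * real k)"
    using card_small_lattice_ball[OF q] by blast
  define \<rho> where "\<rho> = 2 / s0"
  have \<rho>: "0 < \<rho>" "2 / \<rho> = s0" using s0 by (auto simp: \<rho>_def)
  have Ltop: "filterlim L at_top sequentially" using L by (simp add: L_def [abs_def])
  then have Linv: "(\<lambda>N. inverse (L N)) \<longlonglongrightarrow> 0"
    by (rule tendsto_inverse_0_at_top)
  have stop: "filterlim s at_top sequentially"
    using filterlim_tendsto_pos_mult_at_top[OF tendsto_const[of "M / 2"] _ Ltop] M
    by (simp add: s_def [abs_def])
  have a: "a \<longlonglongrightarrow> C"
    unfolding a_def C_def by (rule filterlim_compose[OF ball_density_tendsto[OF q] k])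
  have "(\<lambda>N. a N * (M / 2 - inverse (L N))) \<longlonglongrightarrow> C * (M / 2 - 0)"
    by (intro tendsto_intros a Linv)
  moreover have "C * (M / 2 - 0) = 1 + \<epsilon>" using C by (simp add: M_def)
  ultimately have "\<forall>\<^sub>F N in sequentially. 1 + \<epsilon> / 2 < a N * (M / 2 - inverse (L N))"
    using \<epsilon> by (intro order_tendstoD(1)) auto
  moreover have "\<forall>\<^sub>F N in sequentially. \<forall>g\<ge>2. g \<le> \<rho> * s N \<longrightarrow>
    g powr (- \<delta>) * ((1 + g / s N) / (1 - 1 / s N)) \<le> g powr (- \<delta> / 2)"
    using filterlim_iff[THEN iffD1, OF stop] eventually_intermediate_moduli[OF \<delta>(1) \<rho>(1)] by blast
  moreover have "\<forall>\<^sub>F N in sequentially. 1 < s N" using stop by (simp add: filterlim_at_top_dense)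
  moreover have "\<forall>\<^sub>F N in sequentially. 0 < L N" using Ltop by (simp add: filterlim_at_top_dense)
  moreover have "filterlim (\<lambda>N. real (k N)) at_top sequentially"
    by (rule filterlim_compose[OF filterlim_real_sequentially k])
  then have "\<forall>\<^sub>F N in sequentially. 4 / \<delta> \<le> real (k N)" by (simp add: filterlim_at_top)
  moreover have "\<forall>\<^sub>F N in sequentially. 0 < k N"
    using k [unfolded filterlim_at_top, rule_format, of 1] by (simp add: Suc_le_eq)
  moreover note d
  ultimately have bound: "\<forall>\<^sub>F N in sequentially. real (card (?bad N)) / real (Coset.order (G N)) ^ k N
      \<le> (1 / A ^ (2 * k N) + 2 powr (2 - \<delta> * real (k N) / 2)
          + (M * real (k N)) powr (2 / \<delta> - 1) / A ^ k N * inverse (L N)) / (1 / \<beta> - 1)"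
  proof eventually_elim
    case (elim N)
    interpret comm_group "G N" by (rule G)
    have n: "0 < real (Coset.order (G N))"
      using G(2)[of N] by (auto simp: Coset.order_def card_gt_0_iff)
    have R: "(1 + \<epsilon>) * D_const dir q (k N) (Coset.order (G N)) = s N * real (k N) powr recip q"
    proof -
      have "2 * x / C * y / 2 = x * y / C" for x y :: real by simp
      then have "s N = (1 + \<epsilon>) * L N / C" unfolding s_def M_def .
      then show ?thesis by (simp add: D_const_def C_def L_def)
    qed
    have "real (card (?bad N)) * (1 / \<beta> - 1)
     \<le> real (Coset.order (G N)) ^ k N * (1 / A ^ (2 * k N) + 2 powr (2 - \<delta> * real (k N) / 2)
          + (M * real (k N)) powr (2 / \<delta> - 1) / (A ^ k N * L N))"
      unfolding R s_def L_def
    proof (rule card_small_image_lattice_ball_le[OF G(2) q elim(6) elim(7) \<delta> elim(5) \<beta> _ M \<rho>(1)])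
      show "0 < A" using A by simp
      show "1 < M * real (Coset.order (G N)) powr (1 / real (k N)) / 2"
        using elim(3) by (simp add: s_def L_def)
      have "A\<^sup>2 * L N \<le> (a N * (M / 2 - inverse (L N))) * L N"
        using elim(1,4) A by (intro mult_right_mono) auto
      also have "\<dots> = a N * (s N - 1)" using elim(4) by (simp add: s_def field_simps)
      finally show "A\<^sup>2 * real (Coset.order (G N)) powr (1 / real (k N))
          \<le> ball_density dir q (k N) * (M * real (Coset.order (G N)) powr (1 / real (k N)) / 2 - 1)"
        by (simp add: a_def s_def L_def)
      have "exp (ln A * real (k N)) = A ^ k N"
        using A by (simp add: exp_of_nat2_mult)
      then show "real (card (lattice_ball Undirected q (k N) (2 / \<rho> * real (k N) powr recip q))) \<le> A ^ k N"
        using small[OF elim(6)] \<rho> by simp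
    next
      fix g :: nat
      assume "2 \<le> g" "real g \<le> \<rho> * (M * real (Coset.order (G N)) powr (1 / real (k N)) / 2)"
      then show "real g powr - \<delta> * ((1 + real g / (M * real (Coset.order (G N)) powr (1 / real (k N)) / 2)) /
          (1 - 1 / (M * real (Coset.order (G N)) powr (1 / real (k N)) / 2))) \<le> real g powr (- \<delta> / 2)"
        using elim(2) unfolding s_def L_def by (metis of_nat_le_iff of_nat_numeral)
    qed
    moreover have "0 < 1 / \<beta> - 1" using \<beta> by simp
    ultimately show ?case
      using n elim(4) by (simp add: field_simps)
  qed
  have "(\<lambda>N. (1 / A ^ (2 * k N) + 2 powr (2 - \<delta> * real (k N) / 2)
          + (M * real (k N)) powr (2 / \<delta> - 1) / A ^ k N * inverse (L N)) / (1 / \<beta> - 1)) \<longlonglongrightarrow> (0 + 0 + 0 * 0) / (1 / \<beta> - 1)"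
  proof (intro tendsto_add tendsto_mult tendsto_divide tendsto_const Linv)
    have "(\<lambda>k::nat. 1 / A ^ (2 * k)) \<longlonglongrightarrow> 0" using A by real_asymp
    then show "(\<lambda>N. 1 / A ^ (2 * k N)) \<longlonglongrightarrow> 0" by (rule filterlim_compose[OF _ k])
    have "(\<lambda>k::nat. 2 powr (2 - \<delta> * real k / 2)) \<longlonglongrightarrow> 0" using \<delta> by real_asymp
    then show "(\<lambda>N. 2 powr (2 - \<delta> * real (k N) / 2)) \<longlonglongrightarrow> 0" by (rule filterlim_compose[OF _ k])
    have "(\<lambda>k::nat. (M * real k) powr (2 / \<delta> - 1) / A ^ k) \<longlonglongrightarrow> 0" using A M by real_asymp
    then show "(\<lambda>N. (M * real (k N)) powr (2 / \<delta> - 1) / A ^ k N) \<longlonglongrightarrow> 0" by (rule filterlim_compose[OF _ k])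
  qed (use \<beta> in auto)
  then show ?thesis
    by (intro tendsto_sandwich[OF _ bound tendsto_const]) auto
qed

theorem theorem4:
  fixes dir :: orientation
    and q :: ereal
    and G :: "nat \<Rightarrow> 'a monoid"
    and k :: "nat \<Rightarrow> nat"
    and M :: "nat \<Rightarrow> 'b measure"
    and Z :: "nat \<Rightarrow> nat \<Rightarrow> 'b \<Rightarrow> 'a"
    and \<beta> :: real
  assumes "1 \<le> q"
    and "\<And>N. comm_group (G N)"
    and "\<And>N. finite (carrier (G N))"
    and "filterlim (\<lambda>N. Coset.order (G N)) at_top sequentially"
    and "\<And>N. 0 < k N"
    and "(\<lambda>N. 1) \<lless> (\<lambda>N. real (k N))"
    and "(\<lambda>N. real (k N)) \<lless> (\<lambda>N. ln (real (Coset.order (G N))))"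
    and "(\<lambda>N. real (k N) powr recip q * real (Coset.order (G N)) powr (1 / real (k N)))
           \<lless> (\<lambda>N. real (m_star (G N)))"
    and "1 < q \<Longrightarrow> q < \<infinity> \<Longrightarrow>
           \<forall>\<^sub>F N in sequentially.
             real (k N) \<le> ln (real (Coset.order (G N))) / ln (ln (real (Coset.order (G N))))"
    and "limsup (\<lambda>N. ereal (real (min_generators (G N)) / real (k N)))
           < (case dir of Undirected \<Rightarrow> 1 | Directed \<Rightarrow> 1 / 2)"
    and "\<And>N. prob_space (M N)"
    and "\<And>N. iid_uniform (M N) (G N) (k N) (Z N)"
    and "0 < \<beta>" and "\<beta> < 1"
  shows "tendsto_in_prob M
           (\<lambda>N \<omega>. typical_distance q dir (G N) (k N) (\<lambda>i. Z N i \<omega>) \<beta>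
                    / ereal (D_const dir q (k N) (Coset.order (G N)))) 1"
  unfolding tendsto_in_prob_def
proof (intro allI impI)
  fix \<epsilon> :: real
  assume \<epsilon>: "0 < \<epsilon>"
  define n where "n N = Coset.order (G N)" for N
  define D where "D N = D_const dir q (k N) (n N)" for N
  \<comment> \<open>The lower bound on the distance requires \<epsilon> < 1, and a smaller
    \<epsilon> gives the stronger conclusion.\<close>
  define \<epsilon>' where "\<epsilon>' = min \<epsilon> (1 / 2)"
  have \<epsilon>': "0 < \<epsilon>'" "\<epsilon>' < 1" "\<epsilon>' \<le> \<epsilon>" using \<epsilon> by (auto simp: \<epsilon>'_def)
  have "filterlim (\<lambda>N. 1 / (1 / real (k N))) at_top sequentially"
    using assms(5,6) by (intro LIM_at_top_divide tendsto_const) (auto simp: much_less_def)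
  then have "filterlim (\<lambda>N. real (k N)) at_top sequentially" by simp
  then have k: "filterlim k at_top sequentially"
    unfolding filterlim_at_top by (metis (mono_tags, lifting) eventually_mono of_nat_le_iff)
  have n1: "\<forall>\<^sub>F N in sequentially. 3 \<le> n N"
    using assms(4) [unfolded filterlim_at_top, rule_format, of 3] by (simp add: n_def)
  \<comment> \<open>Since k << ln n, the root n powr (1 / k) = exp (ln n / k) tends to
    infinity.\<close>
  have "filterlim (\<lambda>N. 1 / (real (k N) / ln (real (n N)))) at_top sequentially"
    using assms(7)
  proof (intro LIM_at_top_divide tendsto_const)
    show "\<forall>\<^sub>F N in sequentially. 0 < real (k N) / ln (real (n N))"
      using n1 by eventually_elim (use assms(5) in auto)
  qed (auto simp: much_less_def n_def)
  then have "filterlim (\<lambda>N. exp (1 / (real (k N) / ln (real (n N))))) at_top sequentially"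
    by (rule filterlim_compose[OF exp_at_top])
  moreover have "\<forall>\<^sub>F N in sequentially. exp (1 / (real (k N) / ln (real (n N)))) = real (n N) powr (1 / real (k N))"
    using n1 by eventually_elim (auto simp: powr_def)
  ultimately have L: "filterlim (\<lambda>N. real (n N) powr (1 / real (k N))) at_top sequentially"
    by (rule iffD1[OF filterlim_cong[OF refl refl], rotated])
  have "(case dir of Undirected \<Rightarrow> 1 | Directed \<Rightarrow> 1 / 2) \<le> (1 :: ereal)"
    by (simp add: one_ereal_def split: orientation.splits)
  with assms(10) have "limsup (\<lambda>N. ereal (real (min_generators (G N)) / real (k N))) < 1"
    by (rule less_le_trans)
  then obtain r where r: "limsup (\<lambda>N. ereal (real (min_generators (G N)) / real (k N))) < ereal r" "ereal r < 1"
    using ereal_dense2 by blast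
  define \<delta> where "\<delta> = min (1 - r) (1 / 2)"
  have \<delta>: "0 < \<delta>" "\<delta> < 1" "r \<le> 1 - \<delta>" using r(2) by (auto simp: \<delta>_def)
  have d: "\<forall>\<^sub>F N in sequentially. real (min_generators (G N)) \<le> (1 - \<delta>) * real (k N)"
    using Limsup_lessD[OF r(1)]
  proof eventually_elim
    case (elim N)
    then have "real (min_generators (G N)) \<le> r * real (k N)"
      using assms(5)[of N] by (simp add: divide_less_eq)
    also have "\<dots> \<le> (1 - \<delta>) * real (k N)" using \<delta> by (intro mult_right_mono) auto
    finally show ?case .
  qed
  define bad where "bad N = {z \<in> {..<k N} \<rightarrow>\<^sub>E carrier (G N).
      real (card (power_product (G N) {..<k N} z ` lattice_ball dir q (k N) ((1 + \<epsilon>') * D N)))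
      < \<beta> * real (n N)}" for N
  have lim: "(\<lambda>N. real (card (bad N)) / real (n N) ^ k N) \<longlonglongrightarrow> 0"
    unfolding bad_def D_def n_def
    by (rule card_small_image_asymp[OF assms(1,2,3) k L[unfolded n_def] \<delta>(1,2) d assms(13,14) \<epsilon>'(1)])
  have lower: "\<forall>\<^sub>F N in sequentially. real (card (lattice_ball dir q (k N) ((1 - \<epsilon>') * D N))) < \<beta> * real (n N)"
    unfolding D_def by (rule eventually_card_lattice_ball_small[OF assms(1) k L assms(13) \<epsilon>'(1,2)])
  let ?far = "\<lambda>N. {\<omega> \<in> space (M N). ereal \<epsilon> < \<bar>typical_distance q dir (G N) (k N) (\<lambda>i. Z N i \<omega>) \<beta>
        / ereal (D_const dir q (k N) (Coset.order (G N))) - ereal 1\<bar>}"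
  have "\<forall>\<^sub>F N in sequentially. measure (M N) (?far N) \<le> real (card (bad N)) / real (n N) ^ k N"
    using lower n1
  proof eventually_elim
    case (elim N)
    interpret comm_group "G N" by (rule assms(2))
    interpret prob_space "M N" by (rule assms(11))
    have D: "0 < D N"
      using C_const_pos[OF assms(1), of dir] elim(2) assms(5)[of N] by (simp add: D_def D_const_def)
    have bad: "bad N \<subseteq> {..<k N} \<rightarrow>\<^sub>E carrier (G N)" by (auto simp: bad_def)
    note tuple = iid_uniform_tuple_prob[OF assms(11,12,3,5) bad]
    have "?far N \<subseteq> {\<omega> \<in> space (M N). restrict (\<lambda>i. Z N i \<omega>) {..<k N} \<in> bad N}"
    proof clarify
      fix \<omega> assume \<omega>: "\<omega> \<in> space (M N)"
        and far: "ereal \<epsilon> < \<bar>typical_distance q dir (G N) (k N) (\<lambda>i. Z N i \<omega>) \<beta>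
          / ereal (D_const dir q (k N) (Coset.order (G N))) - ereal 1\<bar>"
      define T where "T = typical_distance q dir (G N) (k N) (\<lambda>i. Z N i \<omega>) \<beta>"
      have z: "Z N i \<omega> \<in> carrier (G N)" if "i < k N" for i
      proof -
        have "Z N i \<in> measurable (M N) (count_space (carrier (G N)))"
          using assms(12)[of N] that by (simp add: iid_uniform_def indep_vars_def)
        from measurable_space[OF this \<omega>] show ?thesis by simp
      qed
      \<comment> \<open>The lower bound only counts lattice points and holds for every outcome; just
        the upper bound can fail, and only on the event \<open>bad\<close>.\<close>
      have T_ge: "ereal ((1 - \<epsilon>') * D N) \<le> T"
        unfolding T_def using elim(1) by (intro typical_distance_ge assms(1,5) z) (auto simp: n_def)
      show "restrict (\<lambda>i. Z N i \<omega>) {..<k N} \<in> bad N"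
      proof (rule ccontr)
        assume "restrict (\<lambda>i. Z N i \<omega>) {..<k N} \<notin> bad N"
        then have "\<beta> * real (n N) \<le> real (card (power_product (G N) {..<k N} (restrict (\<lambda>i. Z N i \<omega>) {..<k N}) `
            lattice_ball dir q (k N) ((1 + \<epsilon>') * D N)))"
          using z by (auto simp: bad_def)
        moreover have "power_product (G N) {..<k N} (restrict (\<lambda>i. Z N i \<omega>) {..<k N}) w
            = power_product (G N) {..<k N} (\<lambda>i. Z N i \<omega>) w" for w
          using z by (intro power_product_cong) auto
        ultimately have T_le: "T \<le> ereal ((1 + \<epsilon>') * D N)"
          unfolding T_def using D \<epsilon>' z
          by (intro typical_distance_le assms(1,3,5)) (auto simp: n_def)
        obtain t where t: "T = ereal t" using T_ge T_le by (cases T) auto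
        have "\<bar>t / D N - 1\<bar> \<le> \<epsilon>'"
          using T_ge T_le D unfolding t by (simp add: abs_le_iff field_simps)
        then have "\<bar>T / ereal (D N) - ereal 1\<bar> \<le> ereal \<epsilon>"
          using D \<epsilon>' by (simp add: t)
        then show False using far by (simp add: T_def D_def n_def not_le [symmetric])
      qed
    qed
    \<comment> \<open>Only the larger event is shown to be measurable. This suffices for the
      inequality, as \<open>measure\<close> is 0 on non-measurable sets.\<close>
    then have "measure (M N) (?far N) \<le> measure (M N) {\<omega> \<in> space (M N). restrict (\<lambda>i. Z N i \<omega>) {..<k N} \<in> bad N}"
      using tuple(1) by (rule finite_measure_mono)
    also have "\<dots> = real (card (bad N)) / real (n N) ^ k N"
      unfolding n_def by (rule tuple(2))
    finally show ?case .
  qed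
  then show "(\<lambda>N. measure (M N) (?far N)) \<longlonglongrightarrow> 0"
    by (intro tendsto_sandwich[OF _ _ tendsto_const lim]) auto
qed

end
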